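(* Let $k$ be a commutative ring and $A$ a $k$-algebra. The forgetful functor $U:\mathcal{YD}^{A^e}\to\mathcal{M}^{A\otimes A}$ (forgetting the left $A$-action) is an isomorphism of categories.
   Context: Conventions: $\otimes=\otimes_k$; algebras are associative and unital; $A$-bimodules are $k$-central, i.e. modules over $A^e=A\otimes A^{\rm op}$. An object of $\mathcal{M}^{A\otimes A}$ (right comodule over the Sweedler canonical coring $A\otimes A$) is a right $A$-module $V$ with a $k$-linear map $\rho: V\to V\otimes A$, written $\rho(v)=v_{[0]}\otimes v_{[1]}$ (summation understood), such that for all $v\in V$, $a\in A$: $v_{[0]}v_{[1]}=v$; $\rho(v_{[0]})\otimes v_{[1]}=v_{[0]}\otimes 1\otimes v_{[1]}$ in $V\otimes A\otimes A$; $\rho(va)=v_{[0]}\otimes v_{[1]}a$. Morphisms are right $A$-linear maps $f$ with $\rho'\circ f=(f\otimes A)\circ\rho$. An object of $\mathcal{YD}^{A^e}$ (right Yetter-Drinfeld $A^e$-module) is a pair $(V,\rho)$ with $V$ an $A$-bimodule and $(V,\rho)\in\mathcal{M}^{A\otimes A}$ such that for all $a\in A$, $v\in V$: $\rho(av)=v_{[0]}\otimes av_{[1]}$ and $av_{[0]}\otimes v_{[1]}=v_{[0]}a\otimes v_{[1]}$. Morphisms are $A$-bimodule maps that are also $A\otimes A$-comodule maps. *)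

theory Defs
  imports "HOL-Algebra.Free_Abelian_Groups" "HOL-Algebra.Generated_Groups" "HOL-Algebra.Module"
begin

section \<open>Algebras over a commutative ring\<close>

text \<open>The locale \<open>algebra\<close> of HOL-Algebra requires a commutative multiplication,
  so the associative unital case is stated here.\<close>

locale k_algebra = module k A + ring A for k (structure) and A (structure) +
  assumes smult_mult_left:
      "\<lbrakk>c \<in> carrier k; a \<in> carrier A; b \<in> carrier A\<rbrakk>
        \<Longrightarrow> (c \<odot>\<^bsub>A\<^esub> a) \<otimes>\<^bsub>A\<^esub> b = c \<odot>\<^bsub>A\<^esub> (a \<otimes>\<^bsub>A\<^esub> b)"
    and smult_mult_right:
      "\<lbrakk>c \<in> carrier k; a \<in> carrier A; b \<in> carrier A\<rbrakk>
        \<Longrightarrow> a \<otimes>\<^bsub>A\<^esub> (c \<odot>\<^bsub>A\<^esub> b) = c \<odot>\<^bsub>A\<^esub> (a \<otimes>\<^bsub>A\<^esub> b)"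

definition linear_map ::
  "('k, 'r) ring_scheme \<Rightarrow> ('k, 'v, 'm) module_scheme \<Rightarrow> ('k, 'w, 'n) module_scheme \<Rightarrow> ('v \<Rightarrow> 'w) \<Rightarrow> bool"
  where "linear_map k V W f \<longleftrightarrow>
    f \<in> hom (add_monoid V) (add_monoid W) \<and>
    (\<forall>c\<in>carrier k. \<forall>v\<in>carrier V. f (c \<odot>\<^bsub>V\<^esub> v) = c \<odot>\<^bsub>W\<^esub> f v)"


section \<open>Tensor products of modules over a commutative ring\<close>

text \<open>The tensor product is the free abelian group on the product of the carriers modulo the
  usual relations. The relation moving scalars across makes it a quotient over \<open>k\<close>;
  the scalar action is then determined by acting on the first factor.\<close>

type_synonym ('v, 'w) tens = "('v \<times> 'w \<Rightarrow>\<^sub>0 int) set"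

definition tensor_relations ::
  "('k, 'r) ring_scheme \<Rightarrow> ('k, 'v, 'm) module_scheme \<Rightarrow> ('k, 'w, 'n) module_scheme \<Rightarrow> ('v, 'w) tens"
  where "tensor_relations k V W =
    {frag_of (v \<oplus>\<^bsub>V\<^esub> v', w) - frag_of (v, w) - frag_of (v', w) | v v' w.
        v \<in> carrier V \<and> v' \<in> carrier V \<and> w \<in> carrier W} \<union>
    {frag_of (v, w \<oplus>\<^bsub>W\<^esub> w') - frag_of (v, w) - frag_of (v, w') | v w w'.
        v \<in> carrier V \<and> w \<in> carrier W \<and> w' \<in> carrier W} \<union>
    {frag_of (c \<odot>\<^bsub>V\<^esub> v, w) - frag_of (v, c \<odot>\<^bsub>W\<^esub> w) | c v w.
        c \<in> carrier k \<and> v \<in> carrier V \<and> w \<in> carrier W}"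

definition tensor_kernel ::
  "('k, 'r) ring_scheme \<Rightarrow> ('k, 'v, 'm) module_scheme \<Rightarrow> ('k, 'w, 'n) module_scheme \<Rightarrow> ('v, 'w) tens"
  where "tensor_kernel k V W =
    generate (free_Abelian_group (carrier V \<times> carrier W)) (tensor_relations k V W)"

definition tensor_group ::
  "('k, 'r) ring_scheme \<Rightarrow> ('k, 'v, 'm) module_scheme \<Rightarrow> ('k, 'w, 'n) module_scheme \<Rightarrow> ('v, 'w) tens monoid"
  where "tensor_group k V W =
    free_Abelian_group (carrier V \<times> carrier W) Mod tensor_kernel k V W"

definition pure_tensor ::
  "('k, 'r) ring_scheme \<Rightarrow> ('k, 'v, 'm) module_scheme \<Rightarrow> ('k, 'w, 'n) module_scheme \<Rightarrow> 'v \<Rightarrow> 'w \<Rightarrow> ('v, 'w) tens"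
  where "pure_tensor k V W v w =
    tensor_kernel k V W #>\<^bsub>free_Abelian_group (carrier V \<times> carrier W)\<^esub> frag_of (v, w)"

text \<open>The homomorphism out of the tensor product induced by \<open>b\<close>. It is well defined whenever
  \<open>b\<close> is \<open>k\<close>-balanced, which is what \<open>tensor_lift_ex1\<close> below establishes; for all other \<open>b\<close>
  its value is unspecified.\<close>

definition tensor_lift ::
  "('k, 'r) ring_scheme \<Rightarrow> ('k, 'v, 'm) module_scheme \<Rightarrow> ('k, 'w, 'n) module_scheme \<Rightarrow>
   ('h, 's) monoid_scheme \<Rightarrow> ('v \<Rightarrow> 'w \<Rightarrow> 'h) \<Rightarrow> ('v, 'w) tens \<Rightarrow> 'h"
  where "tensor_lift k V W H b =
    (THE h. h \<in> extensional (carrier (tensor_group k V W)) \<and> h \<in> hom (tensor_group k V W) H \<and>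
       (\<forall>v\<in>carrier V. \<forall>w\<in>carrier W. h (pure_tensor k V W v w) = b v w))"

definition balanced ::
  "('k, 'r) ring_scheme \<Rightarrow> ('k, 'v, 'm) module_scheme \<Rightarrow> ('k, 'w, 'n) module_scheme \<Rightarrow>
   ('h, 's) monoid_scheme \<Rightarrow> ('v \<Rightarrow> 'w \<Rightarrow> 'h) \<Rightarrow> bool"
  where "balanced k V W H b \<longleftrightarrow>
    (\<forall>v\<in>carrier V. \<forall>w\<in>carrier W. b v w \<in> carrier H) \<and>
    (\<forall>v\<in>carrier V. \<forall>v'\<in>carrier V. \<forall>w\<in>carrier W. b (v \<oplus>\<^bsub>V\<^esub> v') w = b v w \<otimes>\<^bsub>H\<^esub> b v' w) \<and>
    (\<forall>v\<in>carrier V. \<forall>w\<in>carrier W. \<forall>w'\<in>carrier W. b v (w \<oplus>\<^bsub>W\<^esub> w') = b v w \<otimes>\<^bsub>H\<^esub> b v w') \<and>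
    (\<forall>c\<in>carrier k. \<forall>v\<in>carrier V. \<forall>w\<in>carrier W. b (c \<odot>\<^bsub>V\<^esub> v) w = b v (c \<odot>\<^bsub>W\<^esub> w))"

text \<open>The multiplicative part of the ring record underlying a module record carries no
  information for a tensor product.\<close>

definition tensor ::
  "('k, 'r) ring_scheme \<Rightarrow> ('k, 'v, 'm) module_scheme \<Rightarrow> ('k, 'w, 'n) module_scheme \<Rightarrow> ('k, ('v, 'w) tens) module"
  where "tensor k V W =
    \<lparr>carrier = carrier (tensor_group k V W),
     monoid.mult = (\<lambda>_ _. undefined), one = undefined,
     zero = \<one>\<^bsub>tensor_group k V W\<^esub>, add = monoid.mult (tensor_group k V W),
     smult = (\<lambda>c. tensor_lift k V W (tensor_group k V W) (\<lambda>v w. pure_tensor k V W (c \<odot>\<^bsub>V\<^esub> v) w))\<rparr>"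

definition tensor_map ::
  "('k, 'r) ring_scheme \<Rightarrow> ('k, 'v, 'm) module_scheme \<Rightarrow> ('k, 'w, 'n) module_scheme \<Rightarrow>
   ('k, 'x, 'p) module_scheme \<Rightarrow> ('k, 'y, 'q) module_scheme \<Rightarrow>
   ('v \<Rightarrow> 'x) \<Rightarrow> ('w \<Rightarrow> 'y) \<Rightarrow> ('v, 'w) tens \<Rightarrow> ('x, 'y) tens"
  where "tensor_map k V W V' W' f g =
    tensor_lift k V W (tensor_group k V' W') (\<lambda>v w. pure_tensor k V' W' (f v) (g w))"


subsection \<open>The universal property\<close>

lemma tensor_relations_closed:
  assumes "module k V" "module k W"
  shows "tensor_relations k V W \<subseteq> carrier (free_Abelian_group (carrier V \<times> carrier W))"
proof -
  interpret V: module k V by fact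
  interpret W: module k W by fact
  show ?thesis
    unfolding tensor_relations_def
    by (auto dest!: subsetD[OF keys_diff] split: if_splits)
qed

lemma tensor_kernel_normal:
  assumes "module k V" "module k W"
  shows "tensor_kernel k V W \<lhd> free_Abelian_group (carrier V \<times> carrier W)"
proof -
  interpret F: comm_group "free_Abelian_group (carrier V \<times> carrier W)"
    by (rule abelian_free_Abelian_group)
  show ?thesis
    unfolding tensor_kernel_def
    by (simp add: F.normal_iff_subgroup F.generate_is_subgroup tensor_relations_closed[OF assms])
qed

lemma comm_group_tensor_group:
  assumes "module k V" "module k W"
  shows "comm_group (tensor_group k V W)"
proof -
  interpret F: comm_group "free_Abelian_group (carrier V \<times> carrier W)"
    by (rule abelian_free_Abelian_group)
  show ?thesis
    unfolding tensor_group_def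
    using tensor_kernel_normal[OF assms] by (simp add: F.abelian_FactGroup F.normal_iff_subgroup)
qed

lemma hom_free_Abelian_group_diff:
  assumes "h \<in> hom (free_Abelian_group S) H" "group H"
    and "Poly_Mapping.keys x \<subseteq> S" "Poly_Mapping.keys y \<subseteq> S"
  shows "h (x - y) = h x \<otimes>\<^bsub>H\<^esub> inv\<^bsub>H\<^esub> h y"
proof -
  interpret group_hom "free_Abelian_group S" H h
    using assms by (simp add: group_hom_def group_hom_axioms_def)
  show ?thesis
    using hom_mult[of x "- y"] hom_inv[of y] assms(3,4) by simp
qed

lemma hom_tensor_group_eqI:
  assumes "module k V" "module k W" "group H"
    and h: "h \<in> hom (tensor_group k V W) H" and h': "h' \<in> hom (tensor_group k V W) H"
    and eq: "\<And>v w. v \<in> carrier V \<Longrightarrow> w \<in> carrier W \<Longrightarrow>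
      h (pure_tensor k V W v w) = h' (pure_tensor k V W v w)"
    and X: "X \<in> carrier (tensor_group k V W)"
  shows "h X = h' X"
proof -
  let ?F = "free_Abelian_group (carrier V \<times> carrier W)"
  let ?q = "\<lambda>x. tensor_kernel k V W #>\<^bsub>?F\<^esub> x"
  interpret H: group H by fact
  interpret N: normal "tensor_kernel k V W" ?F
    using tensor_kernel_normal[OF assms(1,2)] .
  have q: "?q \<in> hom ?F (tensor_group k V W)"
    unfolding tensor_group_def by (rule N.r_coset_hom_Mod)
  interpret a: group_hom ?F H "h \<circ> ?q"
    using Group.hom_compose[OF q h] by unfold_locales
  interpret b: group_hom ?F H "h' \<circ> ?q"
    using Group.hom_compose[OF q h'] by unfold_locales
  have "h (?q x) = h' (?q x)" if "Poly_Mapping.keys x \<subseteq> carrier V \<times> carrier W" for x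
    using that
  proof (rule free_Abelian_group_induct)
    show "h (?q 0) = h' (?q 0)" using a.hom_one b.hom_one by simp
  next
    fix x y
    assume *: "Poly_Mapping.keys x \<subseteq> carrier V \<times> carrier W" "Poly_Mapping.keys y \<subseteq> carrier V \<times> carrier W"
      "h (?q x) = h' (?q x)" "h (?q y) = h' (?q y)"
    then show "h (?q (x - y)) = h' (?q (x - y))"
      using hom_free_Abelian_group_diff[OF a.homh assms(3), of x y]
        hom_free_Abelian_group_diff[OF b.homh assms(3), of x y]
      by simp
  next
    fix p assume "p \<in> carrier V \<times> carrier W"
    then show "h (?q (frag_of p)) = h' (?q (frag_of p))" using eq unfolding pure_tensor_def by auto
  qed
  moreover obtain x where "x \<in> carrier ?F" "X = ?q x"
    using X unfolding tensor_group_def carrier_FactGroup by auto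
  ultimately show ?thesis by simp
qed

lemma tensor_lift_ex1:
  assumes "module k V" "module k W" "comm_group H" "balanced k V W H b"
  shows "\<exists>!h. h \<in> extensional (carrier (tensor_group k V W)) \<and> h \<in> hom (tensor_group k V W) H \<and>
    (\<forall>v\<in>carrier V. \<forall>w\<in>carrier W. h (pure_tensor k V W v w) = b v w)"
proof -
  let ?F = "free_Abelian_group (carrier V \<times> carrier W)"
  let ?T = "tensor_group k V W"
  interpret V: module k V by fact
  interpret W: module k W by fact
  interpret H: comm_group H by fact
  interpret N: normal "tensor_kernel k V W" ?F
    using tensor_kernel_normal[OF assms(1,2)] .
  have bal: "\<And>v w. v \<in> carrier V \<Longrightarrow> w \<in> carrier W \<Longrightarrow> b v w \<in> carrier H"
    "\<And>v v' w. v \<in> carrier V \<Longrightarrow> v' \<in> carrier V \<Longrightarrow> w \<in> carrier W \<Longrightarrow>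
       b (v \<oplus>\<^bsub>V\<^esub> v') w = b v w \<otimes>\<^bsub>H\<^esub> b v' w"
    "\<And>v w w'. v \<in> carrier V \<Longrightarrow> w \<in> carrier W \<Longrightarrow> w' \<in> carrier W \<Longrightarrow>
       b v (w \<oplus>\<^bsub>W\<^esub> w') = b v w \<otimes>\<^bsub>H\<^esub> b v w'"
    "\<And>c v w. c \<in> carrier k \<Longrightarrow> v \<in> carrier V \<Longrightarrow> w \<in> carrier W \<Longrightarrow>
       b (c \<odot>\<^bsub>V\<^esub> v) w = b v (c \<odot>\<^bsub>W\<^esub> w)"
    using assms(4) unfolding balanced_def by blast+
  have "(\<lambda>(v, w). b v w) ` (carrier V \<times> carrier W) \<subseteq> carrier H"
    using bal(1) by auto
  then obtain g where g: "g \<in> hom ?F H"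
    and g_of: "\<And>p. p \<in> carrier V \<times> carrier W \<Longrightarrow> g (frag_of p) = (\<lambda>(v, w). b v w) p"
    using H.free_Abelian_group_universal by blast
  interpret g: group_hom ?F H g using g by unfold_locales
  have g_diff: "g (x - y) = g x \<otimes>\<^bsub>H\<^esub> inv\<^bsub>H\<^esub> g y"
    if "x \<in> carrier ?F" "y \<in> carrier ?F" for x y
    using hom_free_Abelian_group_diff[OF g H.is_group] that by simp
  have diff_closed: "x - y \<in> carrier ?F" if "x \<in> carrier ?F" "y \<in> carrier ?F" for x y
    using that keys_diff[of x y] by auto
  have g3: "g (x - y - z) = \<one>\<^bsub>H\<^esub>"
    if "x \<in> carrier ?F" "y \<in> carrier ?F" "z \<in> carrier ?F" "g x = g y \<otimes>\<^bsub>H\<^esub> g z" for x y z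
  proof -
    have "g x \<in> carrier H" "g y \<in> carrier H" "g z \<in> carrier H" using that g.hom_closed by auto
    moreover have "g (x - y - z) = g x \<otimes>\<^bsub>H\<^esub> inv\<^bsub>H\<^esub> g y \<otimes>\<^bsub>H\<^esub> inv\<^bsub>H\<^esub> g z"
      using g_diff[OF diff_closed[OF that(1,2)] that(3)] g_diff[OF that(1,2)] by simp
    ultimately show ?thesis
      unfolding that(4) by (metis H.inv_closed H.inv_solve_right' H.m_comm H.r_inv H.m_closed)
  qed
  have "g r = \<one>\<^bsub>H\<^esub>" if "r \<in> tensor_relations k V W" for r
    using that unfolding tensor_relations_def
    by (auto intro!: g3 simp: g_of bal g_diff)
  then have "tensor_relations k V W \<subseteq> kernel ?F H g"
    using tensor_relations_closed[OF assms(1,2)] unfolding kernel_def by blast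
  then have "tensor_kernel k V W \<subseteq> kernel ?F H g"
    unfolding tensor_kernel_def
    by (rule group.generate_subgroup_incl[OF group_free_Abelian_group _ g.subgroup_kernel])
  then obtain f where f: "f \<in> hom ?T H"
    and f_eq: "\<And>x. x \<in> carrier ?F \<Longrightarrow> f (tensor_kernel k V W #>\<^bsub>?F\<^esub> x) = g x"
    using g.FactGroup_universal_kernel[OF N.normal_axioms] unfolding tensor_group_def by blast
  have T: "comm_group ?T" by (rule comm_group_tensor_group[OF assms(1,2)])
  interpret T: comm_group ?T by fact
  have pure: "pure_tensor k V W v w \<in> carrier ?T" if "v \<in> carrier V" "w \<in> carrier W" for v w
    using that unfolding pure_tensor_def tensor_group_def carrier_FactGroup by auto
  show ?thesis
  proof (rule ex1I)
    show "restrict f (carrier ?T) \<in> extensional (carrier ?T) \<and> restrict f (carrier ?T) \<in> hom ?T H \<and>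
      (\<forall>v\<in>carrier V. \<forall>w\<in>carrier W. restrict f (carrier ?T) (pure_tensor k V W v w) = b v w)"
      using f f_eq g_of pure by (auto simp: hom_def pure_tensor_def Pi_iff)
  next
    fix h assume h: "h \<in> extensional (carrier ?T) \<and> h \<in> hom ?T H \<and>
      (\<forall>v\<in>carrier V. \<forall>w\<in>carrier W. h (pure_tensor k V W v w) = b v w)"
    show "h = restrict f (carrier ?T)"
    proof (rule extensionalityI[of _ "carrier ?T"])
      fix X assume X: "X \<in> carrier ?T"
      have "h X = f X"
        by (rule hom_tensor_group_eqI[OF assms(1,2) H.is_group _ f _ X])
          (use h f_eq g_of in \<open>auto simp: pure_tensor_def\<close>)
      then show "h X = restrict f (carrier ?T) X" using X by simp
    qed (use h in auto)
  qed
qed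


section \<open>Right comodules over the Sweedler canonical coring\<close>

text \<open>A \<open>k\<close>-module with a right \<open>A\<close>-action and a map to the tensor product of the module with
  \<open>A\<close>. Since \<open>A\<close> is unital, the compatibility conditions below make the \<open>k\<close>-action the one
  obtained by restricting the \<open>A\<close>-action along \<open>k \<rightarrow> A\<close>.\<close>

record ('k, 'a, 'v) comodule = "('k, 'v) module" +
  ract :: "'v \<Rightarrow> 'a \<Rightarrow> 'v"
  coact :: "'v \<Rightarrow> ('v, 'a) tens"

locale right_module = k_algebra k A + V: module k V
  for k :: "('k, 'r) ring_scheme" and A :: "('k, 'a, 'm) module_scheme"
    and V :: "('k, 'a, 'v, 'z) comodule_scheme" +
  assumes ract_closed: "\<lbrakk>v \<in> carrier V; a \<in> carrier A\<rbrakk> \<Longrightarrow> ract V v a \<in> carrier V"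
    and ract_add_left: "\<lbrakk>v \<in> carrier V; w \<in> carrier V; a \<in> carrier A\<rbrakk>
      \<Longrightarrow> ract V (v \<oplus>\<^bsub>V\<^esub> w) a = ract V v a \<oplus>\<^bsub>V\<^esub> ract V w a"
    and ract_add_right: "\<lbrakk>v \<in> carrier V; a \<in> carrier A; b \<in> carrier A\<rbrakk>
      \<Longrightarrow> ract V v (a \<oplus>\<^bsub>A\<^esub> b) = ract V v a \<oplus>\<^bsub>V\<^esub> ract V v b"
    and ract_mult: "\<lbrakk>v \<in> carrier V; a \<in> carrier A; b \<in> carrier A\<rbrakk>
      \<Longrightarrow> ract V v (a \<otimes>\<^bsub>A\<^esub> b) = ract V (ract V v a) b"
    and ract_one: "v \<in> carrier V \<Longrightarrow> ract V v \<one>\<^bsub>A\<^esub> = v"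
    and ract_smult_left: "\<lbrakk>c \<in> carrier k; v \<in> carrier V; a \<in> carrier A\<rbrakk>
      \<Longrightarrow> ract V (c \<odot>\<^bsub>V\<^esub> v) a = c \<odot>\<^bsub>V\<^esub> ract V v a"
    and ract_smult_right: "\<lbrakk>c \<in> carrier k; v \<in> carrier V; a \<in> carrier A\<rbrakk>
      \<Longrightarrow> ract V v (c \<odot>\<^bsub>A\<^esub> a) = c \<odot>\<^bsub>V\<^esub> ract V v a"

text \<open>In \<open>coassociative\<close>, the triple tensor product is bracketed to the left.\<close>

locale sweedler_comodule = right_module +
  assumes coact_linear: "linear_map k V (tensor k V A) (coact V)"
    and counital: "v \<in> carrier V \<Longrightarrow> tensor_lift k V A (add_monoid V) (ract V) (coact V v) = v"
    and coassociative: "v \<in> carrier V \<Longrightarrow>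
      tensor_map k V A (tensor k V A) A (coact V) (\<lambda>a. a) (coact V v) =
      tensor_map k V A (tensor k V A) A (\<lambda>x. pure_tensor k V A x \<one>\<^bsub>A\<^esub>) (\<lambda>a. a) (coact V v)"
    and coact_ract: "\<lbrakk>v \<in> carrier V; a \<in> carrier A\<rbrakk> \<Longrightarrow>
      coact V (ract V v a) = tensor_map k V A V A (\<lambda>x. x) (\<lambda>b. b \<otimes>\<^bsub>A\<^esub> a) (coact V v)"

definition comodule_map ::
  "('k, 'r) ring_scheme \<Rightarrow> ('k, 'a, 'm) module_scheme \<Rightarrow>
   ('k, 'a, 'v, 'y) comodule_scheme \<Rightarrow> ('k, 'a, 'w, 'z) comodule_scheme \<Rightarrow> ('v \<Rightarrow> 'w) \<Rightarrow> bool"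
  where "comodule_map k A V W f \<longleftrightarrow>
    linear_map k V W f \<and>
    (\<forall>v\<in>carrier V. \<forall>a\<in>carrier A. f (ract V v a) = ract W (f v) a) \<and>
    (\<forall>v\<in>carrier V. coact W (f v) = tensor_map k V A W A f (\<lambda>a. a) (coact V v))"


section \<open>Right Yetter-Drinfeld modules over the enveloping algebra\<close>

record ('k, 'a, 'v) yd_module = "('k, 'a, 'v) comodule" +
  lact :: "'a \<Rightarrow> 'v \<Rightarrow> 'v"

locale bimodule = right_module k A V
  for k :: "('k, 'r) ring_scheme" and A :: "('k, 'a, 'm) module_scheme"
    and V :: "('k, 'a, 'v, 'z) yd_module_scheme" +
  assumes lact_closed: "\<lbrakk>a \<in> carrier A; v \<in> carrier V\<rbrakk> \<Longrightarrow> lact V a v \<in> carrier V"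
    and lact_add_right: "\<lbrakk>a \<in> carrier A; v \<in> carrier V; w \<in> carrier V\<rbrakk>
      \<Longrightarrow> lact V a (v \<oplus>\<^bsub>V\<^esub> w) = lact V a v \<oplus>\<^bsub>V\<^esub> lact V a w"
    and lact_add_left: "\<lbrakk>a \<in> carrier A; b \<in> carrier A; v \<in> carrier V\<rbrakk>
      \<Longrightarrow> lact V (a \<oplus>\<^bsub>A\<^esub> b) v = lact V a v \<oplus>\<^bsub>V\<^esub> lact V b v"
    and lact_mult: "\<lbrakk>a \<in> carrier A; b \<in> carrier A; v \<in> carrier V\<rbrakk>
      \<Longrightarrow> lact V (a \<otimes>\<^bsub>A\<^esub> b) v = lact V a (lact V b v)"
    and lact_one: "v \<in> carrier V \<Longrightarrow> lact V \<one>\<^bsub>A\<^esub> v = v"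
    and lact_smult_right: "\<lbrakk>c \<in> carrier k; a \<in> carrier A; v \<in> carrier V\<rbrakk>
      \<Longrightarrow> lact V a (c \<odot>\<^bsub>V\<^esub> v) = c \<odot>\<^bsub>V\<^esub> lact V a v"
    and lact_smult_left: "\<lbrakk>c \<in> carrier k; a \<in> carrier A; v \<in> carrier V\<rbrakk>
      \<Longrightarrow> lact V (c \<odot>\<^bsub>A\<^esub> a) v = c \<odot>\<^bsub>V\<^esub> lact V a v"
    and lact_ract: "\<lbrakk>a \<in> carrier A; v \<in> carrier V; b \<in> carrier A\<rbrakk>
      \<Longrightarrow> ract V (lact V a v) b = lact V a (ract V v b)"

locale yetter_drinfeld = bimodule k A V + sweedler_comodule k A V
  for k :: "('k, 'r) ring_scheme" and A :: "('k, 'a, 'm) module_scheme"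
    and V :: "('k, 'a, 'v, 'z) yd_module_scheme" +
  assumes coact_lact: "\<lbrakk>a \<in> carrier A; v \<in> carrier V\<rbrakk> \<Longrightarrow>
      coact V (lact V a v) = tensor_map k V A V A (\<lambda>x. x) (\<lambda>b. a \<otimes>\<^bsub>A\<^esub> b) (coact V v)"
    and coact_balanced: "\<lbrakk>a \<in> carrier A; v \<in> carrier V\<rbrakk> \<Longrightarrow>
      tensor_map k V A V A (lact V a) (\<lambda>b. b) (coact V v) =
      tensor_map k V A V A (\<lambda>x. ract V x a) (\<lambda>b. b) (coact V v)"

definition yd_map ::
  "('k, 'r) ring_scheme \<Rightarrow> ('k, 'a, 'm) module_scheme \<Rightarrow>
   ('k, 'a, 'v, 'y) yd_module_scheme \<Rightarrow> ('k, 'a, 'w, 'z) yd_module_scheme \<Rightarrow> ('v \<Rightarrow> 'w) \<Rightarrow> bool"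
  where "yd_map k A V W f \<longleftrightarrow>
    comodule_map k A V W f \<and>
    (\<forall>a\<in>carrier A. \<forall>v\<in>carrier V. f (lact V a v) = lact W a (f v))"


section \<open>Categories and isomorphisms of categories\<close>

record ('o, 'f) category_data =
  Obj :: "'o set"
  Hom :: "'o \<Rightarrow> 'o \<Rightarrow> 'f set"
  Ident :: "'o \<Rightarrow> 'f"
  Comp :: "'o \<Rightarrow> 'o \<Rightarrow> 'o \<Rightarrow> 'f \<Rightarrow> 'f \<Rightarrow> 'f"

text \<open>\<open>Comp C x y z g f\<close> is the composite of \<open>f : x \<rightarrow> y\<close> followed by \<open>g : y \<rightarrow> z\<close>. Hom-sets of
  different pairs of objects may overlap, so arrows are always taken together with their
  source and target.\<close>

locale category =
  fixes C :: "('o, 'f) category_data"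
  assumes Ident_closed: "x \<in> Obj C \<Longrightarrow> Ident C x \<in> Hom C x x"
    and Comp_closed: "\<lbrakk>x \<in> Obj C; y \<in> Obj C; z \<in> Obj C; f \<in> Hom C x y; g \<in> Hom C y z\<rbrakk>
      \<Longrightarrow> Comp C x y z g f \<in> Hom C x z"
    and Comp_Ident_right: "\<lbrakk>x \<in> Obj C; y \<in> Obj C; f \<in> Hom C x y\<rbrakk>
      \<Longrightarrow> Comp C x x y f (Ident C x) = f"
    and Comp_Ident_left: "\<lbrakk>x \<in> Obj C; y \<in> Obj C; f \<in> Hom C x y\<rbrakk>
      \<Longrightarrow> Comp C x y y (Ident C y) f = f"
    and Comp_assoc: "\<lbrakk>w \<in> Obj C; x \<in> Obj C; y \<in> Obj C; z \<in> Obj C;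
        f \<in> Hom C w x; g \<in> Hom C x y; h \<in> Hom C y z\<rbrakk>
      \<Longrightarrow> Comp C w y z h (Comp C w x y g f) = Comp C w x z (Comp C x y z h g) f"

record ('o, 'f, 'p, 'g) functor_data =
  omap :: "'o \<Rightarrow> 'p"
  amap :: "'o \<Rightarrow> 'o \<Rightarrow> 'f \<Rightarrow> 'g"

locale category_functor = C: category C + D: category D
  for C :: "('o, 'f) category_data" and D :: "('p, 'g) category_data" +
  fixes F :: "('o, 'f, 'p, 'g) functor_data"
  assumes omap_closed: "x \<in> Obj C \<Longrightarrow> omap F x \<in> Obj D"
    and amap_closed: "\<lbrakk>x \<in> Obj C; y \<in> Obj C; f \<in> Hom C x y\<rbrakk>
      \<Longrightarrow> amap F x y f \<in> Hom D (omap F x) (omap F y)"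
    and amap_Ident: "x \<in> Obj C \<Longrightarrow> amap F x x (Ident C x) = Ident D (omap F x)"
    and amap_Comp: "\<lbrakk>x \<in> Obj C; y \<in> Obj C; z \<in> Obj C; f \<in> Hom C x y; g \<in> Hom C y z\<rbrakk>
      \<Longrightarrow> amap F x z (Comp C x y z g f) =
        Comp D (omap F x) (omap F y) (omap F z) (amap F y z g) (amap F x y f)"

definition left_inverse_functor ::
  "('o, 'f) category_data \<Rightarrow> ('p, 'g, 'o, 'f) functor_data \<Rightarrow> ('o, 'f, 'p, 'g) functor_data \<Rightarrow> bool"
  where "left_inverse_functor C G F \<longleftrightarrow>
    (\<forall>x\<in>Obj C. omap G (omap F x) = x) \<and>
    (\<forall>x\<in>Obj C. \<forall>y\<in>Obj C. \<forall>f\<in>Hom C x y. amap G (omap F x) (omap F y) (amap F x y f) = f)"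

definition isomorphism_of_categories ::
  "('o, 'f) category_data \<Rightarrow> ('p, 'g) category_data \<Rightarrow> ('o, 'f, 'p, 'g) functor_data \<Rightarrow> bool"
  where "isomorphism_of_categories C D F \<longleftrightarrow>
    category_functor C D F \<and>
    (\<exists>G. category_functor D C G \<and> left_inverse_functor C G F \<and> left_inverse_functor D F G)"


section \<open>The two categories and the forgetful functor\<close>

text \<open>The structure maps of a record are total functions, so one mathematical module is
  represented by many records differing outside the carrier (and in the ring multiplication
  and unit that HOL-Algebra's module records inherit). Requiring these irrelevant values to be
  \<open>undefined\<close> selects exactly one record per module, so that equality of objects is equality of
  modules. In the same way, morphisms are functions that are extensional on the carrier.

  The carriers of the objects range over the subsets of an arbitrary type \<open>'v\<close>.\<close>

definition normal_comodule ::
  "('k, 'r) ring_scheme \<Rightarrow> ('k, 'a, 'm) module_scheme \<Rightarrow> ('k, 'a, 'v, 'z) comodule_scheme \<Rightarrow> bool"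
  where "normal_comodule k A V \<longleftrightarrow>
    monoid.mult V = (\<lambda>_ _. undefined) \<and> one V = undefined \<and>
    (\<forall>v w. \<not> (v \<in> carrier V \<and> w \<in> carrier V) \<longrightarrow> v \<oplus>\<^bsub>V\<^esub> w = undefined) \<and>
    (\<forall>c v. \<not> (c \<in> carrier k \<and> v \<in> carrier V) \<longrightarrow> c \<odot>\<^bsub>V\<^esub> v = undefined) \<and>
    (\<forall>v a. \<not> (v \<in> carrier V \<and> a \<in> carrier A) \<longrightarrow> ract V v a = undefined) \<and>
    coact V \<in> extensional (carrier V)"

definition normal_yd_module ::
  "('k, 'r) ring_scheme \<Rightarrow> ('k, 'a, 'm) module_scheme \<Rightarrow> ('k, 'a, 'v, 'z) yd_module_scheme \<Rightarrow> bool"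
  where "normal_yd_module k A V \<longleftrightarrow>
    normal_comodule k A V \<and>
    (\<forall>a v. \<not> (a \<in> carrier A \<and> v \<in> carrier V) \<longrightarrow> lact V a v = undefined)"

definition comodule_category ::
  "('k, 'r) ring_scheme \<Rightarrow> ('k, 'a, 'm) module_scheme \<Rightarrow>
   (('k, 'a, 'v) comodule, 'v \<Rightarrow> 'v) category_data"
  where "comodule_category k A =
    \<lparr>Obj = {V. sweedler_comodule k A V \<and> normal_comodule k A V},
     Hom = (\<lambda>V W. {f \<in> extensional (carrier V). comodule_map k A V W f}),
     Ident = (\<lambda>V. \<lambda>v\<in>carrier V. v),
     Comp = (\<lambda>V W X g f. compose (carrier V) g f)\<rparr>"

definition yd_category ::
  "('k, 'r) ring_scheme \<Rightarrow> ('k, 'a, 'm) module_scheme \<Rightarrow>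
   (('k, 'a, 'v) yd_module, 'v \<Rightarrow> 'v) category_data"
  where "yd_category k A =
    \<lparr>Obj = {V. yetter_drinfeld k A V \<and> normal_yd_module k A V},
     Hom = (\<lambda>V W. {f \<in> extensional (carrier V). yd_map k A V W f}),
     Ident = (\<lambda>V. \<lambda>v\<in>carrier V. v),
     Comp = (\<lambda>V W X g f. compose (carrier V) g f)\<rparr>"

definition forget_left_action ::
  "(('k, 'a, 'v) yd_module, 'v \<Rightarrow> 'v, ('k, 'a, 'v) comodule, 'v \<Rightarrow> 'v) functor_data"
  where "forget_left_action = \<lparr>omap = comodule.truncate, amap = (\<lambda>V W f. f)\<rparr>"

end

theory Submission
  imports Defs
begin

text \<open>The left action of a Yetter-Drinfeld module is recovered from its comodule structure: the
  counit gives \<open>a v = (a v)\<^sub>0 (a v)\<^sub>1 = v\<^sub>0 a v\<^sub>1\<close>. Conversely, on any comodule the formula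
  \<open>a v = v\<^sub>0 a v\<^sub>1\<close> defines a left action; both compatibility conditions with the coaction follow
  from \<open>\<rho>(v\<^sub>0) \<otimes> v\<^sub>1 = v\<^sub>0 \<otimes> 1 \<otimes> v\<^sub>1\<close>. Comodule maps preserve the formula, so they are
  automatically left linear.\<close>

section \<open>Tensor products as modules\<close>

text \<open>The element \<open>coact V v\<close> is a coset with no chosen expression as a sum of
  pure tensors, so Sweedler notation has no direct formal counterpart. An expression such as v0 a v1
  is therefore read as the \<open>tensor_lift\<close> of a balanced map, evaluated at
  \<open>coact V v\<close>. Each manipulation of sums becomes an equation between lifts: change the
  map pointwise (\<open>tensor_lift_cong\<close>), pull a homomorphism inside
  (\<open>hom_tensor_lift\<close>), or substitute a coaction given by a \<open>tensor_map\<close>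
  (\<open>tensor_lift_tensor_map\<close>). As \<open>tensor_lift\<close> is unspecified on maps that
  are not balanced, these steps carry balancedness obligations.

  Associativity of the action cannot be read off the formula alone: a(bv) involves the coaction of
  bv, so it rests on \<rho>(bv) = v0 \<otimes> b v1.

  An isomorphism of categories asks for equal objects, here equal records, so the values of the left
  action off the carriers have to be controlled as well.\<close>

lemma hom_pointwise_mult:
  assumes "comm_group H" "f \<in> hom G H" "g \<in> hom G H"
  shows "(\<lambda>x. f x \<otimes>\<^bsub>H\<^esub> g x) \<in> hom G H"
proof -
  interpret H: comm_group H by fact
  show ?thesis
    using assms(2,3) by (auto simp: hom_def Pi_iff H.m_ac)
qed

lemma hom_comp:
  "f \<in> hom G H \<Longrightarrow> g \<in> hom H K \<Longrightarrow> (\<lambda>x. g (f x)) \<in> hom G K"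
  by (auto simp: hom_def Pi_iff)

lemma balancedI:
  assumes "\<And>v w. \<lbrakk>v \<in> carrier V; w \<in> carrier W\<rbrakk> \<Longrightarrow> b v w \<in> carrier H"
    and "\<And>v v' w. \<lbrakk>v \<in> carrier V; v' \<in> carrier V; w \<in> carrier W\<rbrakk>
      \<Longrightarrow> b (v \<oplus>\<^bsub>V\<^esub> v') w = b v w \<otimes>\<^bsub>H\<^esub> b v' w"
    and "\<And>v w w'. \<lbrakk>v \<in> carrier V; w \<in> carrier W; w' \<in> carrier W\<rbrakk>
      \<Longrightarrow> b v (w \<oplus>\<^bsub>W\<^esub> w') = b v w \<otimes>\<^bsub>H\<^esub> b v w'"
    and "\<And>c v w. \<lbrakk>c \<in> carrier k; v \<in> carrier V; w \<in> carrier W\<rbrakk>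
      \<Longrightarrow> b (c \<odot>\<^bsub>V\<^esub> v) w = b v (c \<odot>\<^bsub>W\<^esub> w)"
  shows "balanced k V W H b"
  using assms unfolding balanced_def by blast

lemma balancedD:
  assumes "balanced k V W H b"
  shows "\<lbrakk>v \<in> carrier V; w \<in> carrier W\<rbrakk> \<Longrightarrow> b v w \<in> carrier H"
    and "\<lbrakk>v \<in> carrier V; v' \<in> carrier V; w \<in> carrier W\<rbrakk>
      \<Longrightarrow> b (v \<oplus>\<^bsub>V\<^esub> v') w = b v w \<otimes>\<^bsub>H\<^esub> b v' w"
    and "\<lbrakk>v \<in> carrier V; w \<in> carrier W; w' \<in> carrier W\<rbrakk>
      \<Longrightarrow> b v (w \<oplus>\<^bsub>W\<^esub> w') = b v w \<otimes>\<^bsub>H\<^esub> b v w'"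
    and "\<lbrakk>c \<in> carrier k; v \<in> carrier V; w \<in> carrier W\<rbrakk>
      \<Longrightarrow> b (c \<odot>\<^bsub>V\<^esub> v) w = b v (c \<odot>\<^bsub>W\<^esub> w)"
  using assms unfolding balanced_def by blast+

lemma balanced_hom:
  assumes "balanced k V W H b" "h \<in> hom H K"
  shows "balanced k V W K (\<lambda>v w. h (b v w))"
  using assms by (intro balancedI) (auto simp: balancedD hom_mult hom_in_carrier)

lemma linear_mapI:
  assumes "\<And>v. v \<in> carrier V \<Longrightarrow> f v \<in> carrier W"
    and "\<And>v w. \<lbrakk>v \<in> carrier V; w \<in> carrier V\<rbrakk> \<Longrightarrow> f (v \<oplus>\<^bsub>V\<^esub> w) = f v \<oplus>\<^bsub>W\<^esub> f w"
    and "\<And>c v. \<lbrakk>c \<in> carrier k; v \<in> carrier V\<rbrakk> \<Longrightarrow> f (c \<odot>\<^bsub>V\<^esub> v) = c \<odot>\<^bsub>W\<^esub> f v"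
  shows "linear_map k V W f"
  using assms unfolding linear_map_def by (auto intro!: homI)

lemma linear_mapD:
  assumes "linear_map k V W f"
  shows "f \<in> hom (add_monoid V) (add_monoid W)"
    and "v \<in> carrier V \<Longrightarrow> f v \<in> carrier W"
    and "\<lbrakk>v \<in> carrier V; w \<in> carrier V\<rbrakk> \<Longrightarrow> f (v \<oplus>\<^bsub>V\<^esub> w) = f v \<oplus>\<^bsub>W\<^esub> f w"
    and "\<lbrakk>c \<in> carrier k; v \<in> carrier V\<rbrakk> \<Longrightarrow> f (c \<odot>\<^bsub>V\<^esub> v) = c \<odot>\<^bsub>W\<^esub> f v"
  using assms unfolding linear_map_def by (auto simp: hom_def)

text \<open>Most balanced maps below are \<open>ract V\<close> or \<open>pure_tensor\<close>
  precomposed with linear maps, so this rule replaces unfolding \<open>balanced\<close>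
  again.\<close>

lemma balanced_linear_map:
  assumes "balanced k V W H b" "linear_map k V' V f" "linear_map k W' W g"
  shows "balanced k V' W' H (\<lambda>v w. b (f v) (g w))"
  by (intro balancedI) (simp_all add: balancedD[OF assms(1)] linear_mapD[OF assms(2)] linear_mapD[OF assms(3)])

lemma linear_map_id: "linear_map k V V (\<lambda>v. v)"
  by (intro linear_mapI) simp_all

text \<open>Additively, the module \<open>tensor k V W\<close> is the group
  \<open>tensor_group k V W\<close>, and these rewrites let facts about the group settle goals about
  the module. The scalar action is left alone; \<open>tensor_smult_pure\<close> evaluates it on pure
  tensors.\<close>

lemma tensor_simps [simp]:
  "hom G (add_monoid (tensor k V W)) = hom G (tensor_group k V W)"
  "hom (add_monoid (tensor k V W)) H = hom (tensor_group k V W) H"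
  "carrier (tensor k V W) = carrier (tensor_group k V W)"
  "x \<oplus>\<^bsub>tensor k V W\<^esub> y = x \<otimes>\<^bsub>tensor_group k V W\<^esub> y"
  by (simp_all add: tensor_def tensor_group_def FactGroup_def hom_def)

section \<open>The tensor product of two fixed modules: lifts and module structure\<close>

locale module_pair = V: module k V + W: module k W
  for k :: "('k, 'r) ring_scheme" and V :: "('k, 'v, 'm) module_scheme" and W :: "('k, 'w, 'n) module_scheme"
begin

abbreviation "T \<equiv> tensor_group k V W"

sublocale T: comm_group "tensor_group k V W"
  by (rule comm_group_tensor_group) unfold_locales

lemma modules: "module k V" "module k W"
  by unfold_locales

lemma balanced_cong:
  assumes "\<And>v w. \<lbrakk>v \<in> carrier V; w \<in> carrier W\<rbrakk> \<Longrightarrow> b v w = b' v w"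
    and "balanced k V W H b'"
  shows "balanced k V W H b"
  using assms(2) unfolding balanced_def by (simp add: assms(1))

lemma coset_hom:
  "(\<lambda>x. tensor_kernel k V W #>\<^bsub>free_Abelian_group (carrier V \<times> carrier W)\<^esub> x)
    \<in> hom (free_Abelian_group (carrier V \<times> carrier W)) T"
  unfolding tensor_group_def by (rule normal.r_coset_hom_Mod[OF tensor_kernel_normal[OF modules]])

lemma pure_tensor_closed [simp]:
  "\<lbrakk>v \<in> carrier V; w \<in> carrier W\<rbrakk> \<Longrightarrow> pure_tensor k V W v w \<in> carrier T"
  unfolding pure_tensor_def by (rule hom_in_carrier[OF coset_hom]) simp

lemma coset_relation:
  assumes "r \<in> tensor_relations k V W"
  shows "tensor_kernel k V W #>\<^bsub>free_Abelian_group (carrier V \<times> carrier W)\<^esub> r = \<one>\<^bsub>T\<^esub>"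
proof -
  let ?F = "free_Abelian_group (carrier V \<times> carrier W)"
  interpret N: normal "tensor_kernel k V W" ?F by (rule tensor_kernel_normal[OF modules])
  have "r \<in> tensor_kernel k V W"
    using assms unfolding tensor_kernel_def by (rule generate.incl)
  then show ?thesis
    unfolding tensor_group_def by (simp add: N.rcos_const)
qed

lemma coset_diff:
  assumes "Poly_Mapping.keys x \<subseteq> carrier V \<times> carrier W" "Poly_Mapping.keys y \<subseteq> carrier V \<times> carrier W"
  defines "q \<equiv> \<lambda>x. tensor_kernel k V W #>\<^bsub>free_Abelian_group (carrier V \<times> carrier W)\<^esub> x"
  shows "q (x - y) = q x \<otimes>\<^bsub>T\<^esub> inv\<^bsub>T\<^esub> q y"
  unfolding q_def
  using hom_free_Abelian_group_diff[OF coset_hom T.is_group assms(1,2)] .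

lemma coset_relation_diff:
  assumes "x - y \<in> tensor_relations k V W"
    "Poly_Mapping.keys x \<subseteq> carrier V \<times> carrier W" "Poly_Mapping.keys y \<subseteq> carrier V \<times> carrier W"
  defines "q \<equiv> \<lambda>x. tensor_kernel k V W #>\<^bsub>free_Abelian_group (carrier V \<times> carrier W)\<^esub> x"
  shows "q x = q y"
proof -
  have c: "q x \<in> carrier T" "q y \<in> carrier T"
    using assms(2,3) hom_in_carrier[OF coset_hom] unfolding q_def by auto
  have "q x \<otimes>\<^bsub>T\<^esub> inv\<^bsub>T\<^esub> q y = \<one>\<^bsub>T\<^esub>"
    using coset_relation[OF assms(1)] coset_diff[OF assms(2,3)] unfolding q_def by simp
  then show ?thesis using c by (metis T.inv_closed T.inv_equality T.inv_inv)
qed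

text \<open>Turns a three-term generator into an additivity law: x - y - z is x - (y + z), and the
  coset map is a homomorphism.\<close>

lemma coset_relation_diff2:
  assumes "x - y - z \<in> tensor_relations k V W"
    "Poly_Mapping.keys x \<subseteq> carrier V \<times> carrier W" "Poly_Mapping.keys y \<subseteq> carrier V \<times> carrier W"
    "Poly_Mapping.keys z \<subseteq> carrier V \<times> carrier W"
  defines "q \<equiv> \<lambda>x. tensor_kernel k V W #>\<^bsub>free_Abelian_group (carrier V \<times> carrier W)\<^esub> x"
  shows "q x = q y \<otimes>\<^bsub>T\<^esub> q z"
proof -
  have "Poly_Mapping.keys (y + z) \<subseteq> carrier V \<times> carrier W"
    using assms(3,4) keys_add[of y z] by auto
  moreover have "x - (y + z) \<in> tensor_relations k V W"
    using assms(1) by (simp add: algebra_simps)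
  ultimately have "q x = q (y + z)"
    using coset_relation_diff assms(2) unfolding q_def by blast
  then show ?thesis
    using hom_mult[OF coset_hom, of y z] assms(3,4) unfolding q_def by simp
qed

text \<open>Each family of generators in \<open>tensor_relations\<close> accounts for one clause of
  balancedness.\<close>

lemma balanced_pure_tensor: "balanced k V W T (pure_tensor k V W)"
proof (rule balancedI)
  fix v v' w assume "v \<in> carrier V" "v' \<in> carrier V" "w \<in> carrier W"
  then show "pure_tensor k V W (v \<oplus>\<^bsub>V\<^esub> v') w = pure_tensor k V W v w \<otimes>\<^bsub>T\<^esub> pure_tensor k V W v' w"
    unfolding pure_tensor_def
    by (intro coset_relation_diff2) (auto simp: tensor_relations_def)
next
  fix v w w' assume "v \<in> carrier V" "w \<in> carrier W" "w' \<in> carrier W"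
  then show "pure_tensor k V W v (w \<oplus>\<^bsub>W\<^esub> w') = pure_tensor k V W v w \<otimes>\<^bsub>T\<^esub> pure_tensor k V W v w'"
    unfolding pure_tensor_def
    by (intro coset_relation_diff2) (auto simp: tensor_relations_def)
next
  fix c v w assume "c \<in> carrier k" "v \<in> carrier V" "w \<in> carrier W"
  then show "pure_tensor k V W (c \<odot>\<^bsub>V\<^esub> v) w = pure_tensor k V W v (c \<odot>\<^bsub>W\<^esub> w)"
    unfolding pure_tensor_def
    by (intro coset_relation_diff) (auto simp: tensor_relations_def)
qed simp

lemmas pure_tensor_add_left = balancedD(2)[OF balanced_pure_tensor]
  and pure_tensor_add_right = balancedD(3)[OF balanced_pure_tensor]
  and pure_tensor_smult = balancedD(4)[OF balanced_pure_tensor]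

lemma
  assumes "comm_group H" "balanced k V W H b"
  shows tensor_lift_hom: "tensor_lift k V W H b \<in> hom T H"
    and tensor_lift_pure: "\<lbrakk>v \<in> carrier V; w \<in> carrier W\<rbrakk>
      \<Longrightarrow> tensor_lift k V W H b (pure_tensor k V W v w) = b v w"
  using theI'[OF tensor_lift_ex1[OF modules assms]] unfolding tensor_lift_def by blast+

text \<open>Balancedness of \<open>b\<close> comes for free: on the carriers \<open>b\<close> is a
  homomorphism composed with the balanced map \<open>pure_tensor\<close>. Uniqueness of the lift
  then gives the equation.\<close>

lemma tensor_lift_eqI:
  assumes "comm_group H" "h \<in> hom T H"
    and "\<And>v w. \<lbrakk>v \<in> carrier V; w \<in> carrier W\<rbrakk> \<Longrightarrow> b v w = h (pure_tensor k V W v w)"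
    and "x \<in> carrier T"
  shows "tensor_lift k V W H b x = h x"
proof -
  have "balanced k V W H b"
    using balanced_hom[OF balanced_pure_tensor assms(2)] by (rule balanced_cong[rotated]) (rule assms(3))
  note b = assms(1) this
  show ?thesis
    by (rule hom_tensor_group_eqI[OF modules comm_group.axioms(2)[OF assms(1)]
          tensor_lift_hom[OF b] assms(2) _ assms(4)])
      (simp add: tensor_lift_pure[OF b] assms(3))
qed

text \<open>Only the target map \<open>b'\<close> has to be known to be balanced, so calculations
  rewrite towards the map for which this is available.\<close>

lemma tensor_lift_cong:
  assumes "\<And>v w. \<lbrakk>v \<in> carrier V; w \<in> carrier W\<rbrakk> \<Longrightarrow> b v w = b' v w"
    "comm_group H" "balanced k V W H b'" "x \<in> carrier T"
  shows "tensor_lift k V W H b x = tensor_lift k V W H b' x"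
  using assms by (intro tensor_lift_eqI) (simp_all add: tensor_lift_hom tensor_lift_pure)

lemma hom_tensor_lift:
  assumes "comm_group H" "comm_group K" "balanced k V W H b" "h \<in> hom H K" "x \<in> carrier T"
  shows "h (tensor_lift k V W H b x) = tensor_lift k V W K (\<lambda>v w. h (b v w)) x"
  using assms
  by (intro tensor_lift_eqI[symmetric] hom_comp[OF tensor_lift_hom]) (simp_all add: tensor_lift_pure)

text \<open>Scaling by \<open>c\<close> is \<open>k\<close>-linear because \<open>k\<close> is
  commutative. Hence the scalar action in \<open>tensor\<close> is the lift of a balanced map and is
  well defined.\<close>

lemma balanced_pure_tensor_smult:
  assumes c: "c \<in> carrier k"
  shows "balanced k V W T (\<lambda>v w. pure_tensor k V W (c \<odot>\<^bsub>V\<^esub> v) w)"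
proof -
  have "linear_map k V V (\<lambda>v. c \<odot>\<^bsub>V\<^esub> v)"
    using c by (intro linear_mapI)
      (simp_all add: V.smult_r_distr V.smult_assoc1[symmetric] V.R.m_comm)
  from balanced_linear_map[OF balanced_pure_tensor this linear_map_id[of k W]]
  show ?thesis .
qed

lemma tensor_smult_hom:
  assumes "c \<in> carrier k"
  shows "(\<lambda>x. c \<odot>\<^bsub>tensor k V W\<^esub> x) \<in> hom T T"
  unfolding tensor_def using tensor_lift_hom[OF T.comm_group_axioms balanced_pure_tensor_smult[OF assms]]
  by simp

lemma tensor_smult_pure:
  assumes "c \<in> carrier k" "v \<in> carrier V" "w \<in> carrier W"
  shows "c \<odot>\<^bsub>tensor k V W\<^esub> pure_tensor k V W v w = pure_tensor k V W (c \<odot>\<^bsub>V\<^esub> v) w"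
  unfolding tensor_def using assms
  by (simp add: tensor_lift_pure[OF T.comm_group_axioms balanced_pure_tensor_smult])

text \<open>For fixed scalars, both sides of the remaining scalar laws are homomorphisms in the
  tensor, so they are compared on pure tensors; distributivity over sums of tensors is the
  homomorphism property itself. The result allows the construction to be iterated, as
  coassociativity requires.\<close>

lemma module_tensor: "module k (tensor k V W)"
proof (intro moduleI)
  show "abelian_group (tensor k V W)"
  proof (rule abelian_groupI)
    show "\<zero>\<^bsub>tensor k V W\<^esub> \<in> carrier (tensor k V W)"
      unfolding tensor_def by simp
    show "\<zero>\<^bsub>tensor k V W\<^esub> \<oplus>\<^bsub>tensor k V W\<^esub> x = x" if "x \<in> carrier (tensor k V W)" for x
      using that unfolding tensor_def by simp
    show "\<exists>y\<in>carrier (tensor k V W). y \<oplus>\<^bsub>tensor k V W\<^esub> x = \<zero>\<^bsub>tensor k V W\<^esub>"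
      if "x \<in> carrier (tensor k V W)" for x
      using that T.l_inv_ex unfolding tensor_def by simp
  qed (simp_all add: T.m_ac)
next
  fix c x assume "c \<in> carrier k" "x \<in> carrier (tensor k V W)"
  then show "c \<odot>\<^bsub>tensor k V W\<^esub> x \<in> carrier (tensor k V W)"
    using hom_in_carrier[OF tensor_smult_hom] by simp
next
  fix c d x assume c: "c \<in> carrier k" "d \<in> carrier k" and x: "x \<in> carrier (tensor k V W)"
  show "(c \<oplus>\<^bsub>k\<^esub> d) \<odot>\<^bsub>tensor k V W\<^esub> x = c \<odot>\<^bsub>tensor k V W\<^esub> x \<oplus>\<^bsub>tensor k V W\<^esub> d \<odot>\<^bsub>tensor k V W\<^esub> x"
    unfolding tensor_simps
    by (rule hom_tensor_group_eqI[OF modules T.is_group])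
      (use c x in \<open>auto intro!: hom_pointwise_mult tensor_smult_hom T.comm_group_axioms
        simp: tensor_smult_pure V.smult_l_distr pure_tensor_add_left\<close>)
  show "(c \<otimes>\<^bsub>k\<^esub> d) \<odot>\<^bsub>tensor k V W\<^esub> x = c \<odot>\<^bsub>tensor k V W\<^esub> (d \<odot>\<^bsub>tensor k V W\<^esub> x)"
    by (rule hom_tensor_group_eqI[OF modules T.is_group _ hom_comp[OF tensor_smult_hom tensor_smult_hom]])
      (use c x in \<open>auto intro!: tensor_smult_hom simp: tensor_smult_pure V.smult_assoc1\<close>)
next
  fix c x y assume "c \<in> carrier k" "x \<in> carrier (tensor k V W)" "y \<in> carrier (tensor k V W)"
  then show "c \<odot>\<^bsub>tensor k V W\<^esub> (x \<oplus>\<^bsub>tensor k V W\<^esub> y) =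
      c \<odot>\<^bsub>tensor k V W\<^esub> x \<oplus>\<^bsub>tensor k V W\<^esub> c \<odot>\<^bsub>tensor k V W\<^esub> y"
    using hom_mult[OF tensor_smult_hom] by simp
next
  fix x assume x: "x \<in> carrier (tensor k V W)"
  show "\<one>\<^bsub>k\<^esub> \<odot>\<^bsub>tensor k V W\<^esub> x = x"
    by (rule hom_tensor_group_eqI[OF modules T.is_group tensor_smult_hom, where h' = "\<lambda>x. x"])
      (use x in \<open>auto simp: tensor_smult_pure hom_def\<close>)
qed (rule V.is_cring)

lemma tensor_lift_mult:
  assumes H: "comm_group H" and b: "balanced k V W H b" "balanced k V W H b'" and x: "x \<in> carrier T"
  shows "tensor_lift k V W H (\<lambda>v w. b v w \<otimes>\<^bsub>H\<^esub> b' v w) x =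
    tensor_lift k V W H b x \<otimes>\<^bsub>H\<^esub> tensor_lift k V W H b' x"
  by (rule tensor_lift_eqI[OF H hom_pointwise_mult[OF H tensor_lift_hom[OF H b(1)] tensor_lift_hom[OF H b(2)]] _ x])
    (simp add: tensor_lift_pure H b)

lemma tensor_lift_smult:
  assumes H: "comm_group H" and b: "balanced k V W H b" and c: "c \<in> carrier k" and x: "x \<in> carrier T"
  shows "tensor_lift k V W H b (c \<odot>\<^bsub>tensor k V W\<^esub> x) = tensor_lift k V W H (\<lambda>v w. b (c \<odot>\<^bsub>V\<^esub> v) w) x"
  by (rule tensor_lift_eqI[OF H hom_comp[OF tensor_smult_hom[OF c] tensor_lift_hom[OF H b]] _ x, symmetric])
    (simp add: tensor_lift_pure[OF H b] tensor_smult_pure c)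

text \<open>Balancedness yields additivity of the lift but only moves scalars between the two
  factors. The assumption \<open>smult\<close> ties them to the scalar action on
  \<open>X\<close>.\<close>

lemma tensor_lift_linear:
  assumes X: "module k X" and b: "balanced k V W (add_monoid X) b"
    and smult: "\<And>c v w. \<lbrakk>c \<in> carrier k; v \<in> carrier V; w \<in> carrier W\<rbrakk>
      \<Longrightarrow> b (c \<odot>\<^bsub>V\<^esub> v) w = c \<odot>\<^bsub>X\<^esub> b v w"
  shows "linear_map k (tensor k V W) X (tensor_lift k V W (add_monoid X) b)"
proof (rule linear_mapI)
  interpret X: module k X by fact
  note H = X.a_comm_group
  note hom = tensor_lift_hom[OF H b]
  fix x assume x: "x \<in> carrier (tensor k V W)"
  then show "tensor_lift k V W (add_monoid X) b x \<in> carrier X"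
    using hom_in_carrier[OF hom] by simp
  show "tensor_lift k V W (add_monoid X) b (x \<oplus>\<^bsub>tensor k V W\<^esub> y) =
      tensor_lift k V W (add_monoid X) b x \<oplus>\<^bsub>X\<^esub> tensor_lift k V W (add_monoid X) b y"
    if "y \<in> carrier (tensor k V W)" for y
    using x that hom_mult[OF hom, of x y] by simp
  fix c assume c: "c \<in> carrier k"
  have scale: "(\<lambda>u. c \<odot>\<^bsub>X\<^esub> u) \<in> hom (add_monoid X) (add_monoid X)"
    using c by (auto intro!: homI simp: X.smult_r_distr)
  have "tensor_lift k V W (add_monoid X) b (c \<odot>\<^bsub>tensor k V W\<^esub> x) =
      tensor_lift k V W (add_monoid X) (\<lambda>v w. b (c \<odot>\<^bsub>V\<^esub> v) w) x"
    using x by (intro tensor_lift_smult H b c) simp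
  also have "\<dots> = tensor_lift k V W (add_monoid X) (\<lambda>v w. c \<odot>\<^bsub>X\<^esub> b v w) x"
    using x by (intro tensor_lift_cong H balanced_hom[OF b scale]) (simp_all add: smult c)
  also have "\<dots> = c \<odot>\<^bsub>X\<^esub> tensor_lift k V W (add_monoid X) b x"
    using x by (intro hom_tensor_lift[OF H H b scale, symmetric]) simp
  finally show "tensor_lift k V W (add_monoid X) b (c \<odot>\<^bsub>tensor k V W\<^esub> x) =
      c \<odot>\<^bsub>X\<^esub> tensor_lift k V W (add_monoid X) b x" .
qed

text \<open>Describes maps out of the left-bracketed product (V \<otimes> W) \<otimes> X by a
  function of three variables. Scalars pass between the first and the third variable because the
  action on \<open>tensor k V W\<close> is defined through the first factor.\<close>

lemma balanced_trilinear:
  assumes H: "comm_group H"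
    and b: "\<And>x. x \<in> carrier X \<Longrightarrow> balanced k V W H (\<lambda>v w. t v w x)"
    and add: "\<And>v w x y. \<lbrakk>v \<in> carrier V; w \<in> carrier W; x \<in> carrier X; y \<in> carrier X\<rbrakk>
      \<Longrightarrow> t v w (x \<oplus>\<^bsub>X\<^esub> y) = t v w x \<otimes>\<^bsub>H\<^esub> t v w y"
    and smult: "\<And>c v w x. \<lbrakk>c \<in> carrier k; v \<in> carrier V; w \<in> carrier W; x \<in> carrier X\<rbrakk>
      \<Longrightarrow> t (c \<odot>\<^bsub>V\<^esub> v) w x = t v w (c \<odot>\<^bsub>X\<^esub> x)"
    and X: "module k X"
  shows "balanced k (tensor k V W) X H (\<lambda>u x. tensor_lift k V W H (\<lambda>v w. t v w x) u)"
proof (rule balancedI)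
  interpret X: module k X by fact
  fix u x assume u: "u \<in> carrier (tensor k V W)" and x: "x \<in> carrier X"
  note hom = tensor_lift_hom[OF H b[OF x]]
  show "tensor_lift k V W H (\<lambda>v w. t v w x) u \<in> carrier H"
    using u hom_in_carrier[OF hom] by simp
  show "tensor_lift k V W H (\<lambda>v w. t v w x) (u \<oplus>\<^bsub>tensor k V W\<^esub> u') =
      tensor_lift k V W H (\<lambda>v w. t v w x) u \<otimes>\<^bsub>H\<^esub> tensor_lift k V W H (\<lambda>v w. t v w x) u'"
    if "u' \<in> carrier (tensor k V W)" for u'
    using u that hom_mult[OF hom, of u u'] by simp
  show "tensor_lift k V W H (\<lambda>v w. t v w (x \<oplus>\<^bsub>X\<^esub> y)) u =
      tensor_lift k V W H (\<lambda>v w. t v w x) u \<otimes>\<^bsub>H\<^esub> tensor_lift k V W H (\<lambda>v w. t v w y) u"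
    if y: "y \<in> carrier X" for y
  proof -
    \<comment> \<open>The pointwise product is balanced because it agrees on the carriers with
      \<open>t\<close> at the single element \<open>x \<oplus> y\<close>.\<close>
    have "balanced k V W H (\<lambda>v w. t v w x \<otimes>\<^bsub>H\<^esub> t v w y)"
      by (rule balanced_cong[OF _ b[of "x \<oplus>\<^bsub>X\<^esub> y"]]) (simp_all add: add x y)
    then have "tensor_lift k V W H (\<lambda>v w. t v w (x \<oplus>\<^bsub>X\<^esub> y)) u =
        tensor_lift k V W H (\<lambda>v w. t v w x \<otimes>\<^bsub>H\<^esub> t v w y) u"
      using u by (intro tensor_lift_cong H) (simp_all add: add x y)
    then show ?thesis using u by (simp add: tensor_lift_mult H b x y)
  qed
  show "tensor_lift k V W H (\<lambda>v w. t v w x) (c \<odot>\<^bsub>tensor k V W\<^esub> u) =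
      tensor_lift k V W H (\<lambda>v w. t v w (c \<odot>\<^bsub>X\<^esub> x)) u" if c: "c \<in> carrier k" for c
  proof -
    have "tensor_lift k V W H (\<lambda>v w. t v w x) (c \<odot>\<^bsub>tensor k V W\<^esub> u) =
        tensor_lift k V W H (\<lambda>v w. t (c \<odot>\<^bsub>V\<^esub> v) w x) u"
      using u by (intro tensor_lift_smult H b x c) simp
    also have "\<dots> = tensor_lift k V W H (\<lambda>v w. t v w (c \<odot>\<^bsub>X\<^esub> x)) u"
      using u by (intro tensor_lift_cong H b) (simp_all add: smult x c)
    finally show ?thesis .
  qed
qed

end

section \<open>Functoriality of the tensor product\<close>

text \<open>The substitution rule for Sweedler sums: every axiom that expresses a coaction as a
  \<open>tensor_map\<close> of another one enters calculations through it. Both sides are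
  homomorphisms in \<open>x\<close> with the same values on pure tensors.\<close>

lemma tensor_lift_tensor_map:
  assumes "module_pair k V W" "module_pair k V' W'" "linear_map k V V' f" "linear_map k W W' g"
    and H: "comm_group H" and b: "balanced k V' W' H b" and x: "x \<in> carrier (tensor_group k V W)"
  shows "tensor_lift k V' W' H b (tensor_map k V W V' W' f g x) = tensor_lift k V W H (\<lambda>v w. b (f v) (g w)) x"
proof -
  interpret P: module_pair k V W by fact
  interpret Q: module_pair k V' W' by fact
  note fg = Q.T.comm_group_axioms balanced_linear_map[OF Q.balanced_pure_tensor assms(3,4)]
  show ?thesis
    unfolding tensor_map_def
    by (rule P.tensor_lift_eqI[OF H hom_comp[OF P.tensor_lift_hom[OF fg] Q.tensor_lift_hom[OF H b]] _ x, symmetric])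
      (simp add: P.tensor_lift_pure[OF fg] Q.tensor_lift_pure[OF H b] linear_mapD[OF assms(3)] linear_mapD[OF assms(4)])
qed

text \<open>Nothing is assumed of \<open>f'\<close> and \<open>g'\<close> off the carriers. This
  absorbs the restrictions in the identities and composites of the categories, as well as the
  default values of \<open>lact\<close>.\<close>

lemma tensor_map_cong:
  assumes "module_pair k V W" "module_pair k V' W'" "linear_map k V V' f" "linear_map k W W' g"
    and eq: "\<And>v. v \<in> carrier V \<Longrightarrow> f' v = f v" "\<And>w. w \<in> carrier W \<Longrightarrow> g' w = g w"
    and x: "x \<in> carrier (tensor_group k V W)"
  shows "tensor_map k V W V' W' f' g' x = tensor_map k V W V' W' f g x"
proof -
  interpret P: module_pair k V W by fact
  interpret Q: module_pair k V' W' by fact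
  show ?thesis
    unfolding tensor_map_def using x
    by (intro P.tensor_lift_cong Q.T.comm_group_axioms balanced_linear_map[OF Q.balanced_pure_tensor assms(3,4)])
      (simp_all add: eq)
qed

lemma tensor_map_id:
  assumes "module_pair k V W" and x: "x \<in> carrier (tensor_group k V W)"
  shows "tensor_map k V W V W (\<lambda>v. v) (\<lambda>w. w) x = x"
proof -
  interpret P: module_pair k V W by fact
  show ?thesis
    unfolding tensor_map_def
    by (rule P.tensor_lift_eqI[OF P.T.comm_group_axioms _ _ x, where h = "\<lambda>x. x"]) (auto simp: hom_def)
qed

lemma tensor_map_comp:
  assumes "module_pair k V W" "module_pair k V' W'" "module_pair k V'' W''"
    and "linear_map k V V' f" "linear_map k W W' g" "linear_map k V' V'' f'" "linear_map k W' W'' g'"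
    and x: "x \<in> carrier (tensor_group k V W)"
  shows "tensor_map k V' W' V'' W'' f' g' (tensor_map k V W V' W' f g x) =
    tensor_map k V W V'' W'' (\<lambda>v. f' (f v)) (\<lambda>w. g' (g w)) x"
proof -
  interpret R: module_pair k V'' W'' by fact
  show ?thesis
    unfolding tensor_map_def[of k V' W' V''] tensor_map_def[of k V W V'']
    by (rule tensor_lift_tensor_map[OF assms(1,2,4,5) R.T.comm_group_axioms
          balanced_linear_map[OF R.balanced_pure_tensor assms(6,7)] x])
qed


section \<open>The left action of a comodule\<close>

text \<open>This is the coaction followed by the map x \<otimes> b \<mapsto> x a b from V \<otimes>
  A to V. The scheme type makes it applicable to comodules and to Yetter-Drinfeld records
  alike.\<close>

definition left_action ::
  "('k, 'r) ring_scheme \<Rightarrow> ('k, 'a, 'm) module_scheme \<Rightarrow> ('k, 'a, 'v, 'z) comodule_scheme \<Rightarrow> 'a \<Rightarrow> 'v \<Rightarrow> 'v"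
  where "left_action k A V a v =
    tensor_lift k V A (add_monoid V) (\<lambda>x b. ract V (ract V x a) b) (coact V v)"

context right_module
begin

sublocale VA: module_pair k V A
  by unfold_locales

sublocale VAA: module_pair k "tensor k V A" A
  by (intro module_pair.intro VA.module_tensor VA.modules)

lemma linear_map_mult_left: "a \<in> carrier A \<Longrightarrow> linear_map k A A (\<lambda>b. a \<otimes>\<^bsub>A\<^esub> b)"
  by (intro linear_mapI) (simp_all add: smult_mult_right r_distr)

lemma linear_map_mult_right: "a \<in> carrier A \<Longrightarrow> linear_map k A A (\<lambda>b. b \<otimes>\<^bsub>A\<^esub> a)"
  by (intro linear_mapI) (simp_all add: smult_mult_left l_distr)

lemma linear_map_ract: "a \<in> carrier A \<Longrightarrow> linear_map k V V (\<lambda>v. ract V v a)"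
  by (intro linear_mapI) (simp_all add: ract_closed ract_add_left ract_smult_left)

lemma balanced_ract: "balanced k V A (add_monoid V) (ract V)"
  by (intro balancedI) (simp_all add: ract_closed ract_add_left ract_add_right ract_smult_left ract_smult_right)

lemma balanced_ract_ract:
  "a \<in> carrier A \<Longrightarrow> balanced k V A (add_monoid V) (\<lambda>x b. ract V (ract V x a) b)"
  by (rule balanced_linear_map[OF balanced_ract linear_map_ract linear_map_id])

end

section \<open>Bimodule axioms and coaction compatibility for the induced left action\<close>

context sweedler_comodule
begin

lemma coact_closed [simp]: "v \<in> carrier V \<Longrightarrow> coact V v \<in> carrier VA.T"
  using linear_mapD(2)[OF coact_linear] by simp

text \<open>The working form of coassociativity: under any balanced map out of (V \<otimes> A)
  \<otimes> A, the inner coaction \<rho>(v0) may be replaced by v0 \<otimes> 1. Applying the map to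
  both sides of the axiom gives it.\<close>

lemma tensor_lift_coassociative:
  assumes H: "comm_group H" and b: "balanced k (tensor k V A) A H b" and v: "v \<in> carrier V"
  shows "tensor_lift k V A H (\<lambda>x c. b (coact V x) c) (coact V v) =
    tensor_lift k V A H (\<lambda>x c. b (pure_tensor k V A x \<one>\<^bsub>A\<^esub>) c) (coact V v)"
proof -
  have "linear_map k V (tensor k V A) (\<lambda>x. pure_tensor k V A x \<one>\<^bsub>A\<^esub>)"
    by (intro linear_mapI) (simp_all add: VA.pure_tensor_add_left VA.tensor_smult_pure)
  note maps = VA.module_pair_axioms VAA.module_pair_axioms this linear_map_id[of k A]
  note maps' = VA.module_pair_axioms VAA.module_pair_axioms coact_linear linear_map_id[of k A]
  show ?thesis
    using tensor_lift_tensor_map[OF maps' H b coact_closed[OF v]]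
      tensor_lift_tensor_map[OF maps H b coact_closed[OF v]] coassociative[OF v]
    by simp
qed

lemma left_action_linear:
  assumes a: "a \<in> carrier A"
  shows "linear_map k V V (left_action k A V a)"
proof -
  have "linear_map k (tensor k V A) V (tensor_lift k V A (add_monoid V) (\<lambda>x b. ract V (ract V x a) b))"
    by (rule VA.tensor_lift_linear[OF VA.modules(1) balanced_ract_ract[OF a]])
      (simp add: ract_smult_left ract_closed a)
  then show ?thesis
    unfolding left_action_def[abs_def] using coact_linear unfolding linear_map_def
    by (auto intro: hom_comp simp: hom_in_carrier)
qed

text \<open>For the unit, v0 1 v1 = v0 v1, which the counit axiom evaluates to v.\<close>

lemma left_action_one:
  assumes v: "v \<in> carrier V"
  shows "left_action k A V \<one>\<^bsub>A\<^esub> v = v"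
proof -
  have "left_action k A V \<one>\<^bsub>A\<^esub> v = tensor_lift k V A (add_monoid V) (ract V) (coact V v)"
    unfolding left_action_def
    by (intro VA.tensor_lift_cong V.a_comm_group balanced_ract) (simp_all add: ract_one v)
  then show ?thesis using counital[OF v] by simp
qed

lemma left_action_add_left:
  assumes a: "a \<in> carrier A" and b: "b \<in> carrier A" and v: "v \<in> carrier V"
  shows "left_action k A V (a \<oplus>\<^bsub>A\<^esub> b) v = left_action k A V a v \<oplus>\<^bsub>V\<^esub> left_action k A V b v"
proof -
  have eq: "ract V (ract V x (a \<oplus>\<^bsub>A\<^esub> b)) c =
      ract V (ract V x a) c \<otimes>\<^bsub>add_monoid V\<^esub> ract V (ract V x b) c"
    if "x \<in> carrier V" "c \<in> carrier A" for x c
    using that a b by (simp add: ract_add_right ract_add_left ract_closed)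
  \<comment> \<open>Inherited from the map for the single element \<open>a \<oplus> b\<close>, with
    which it agrees on the carriers.\<close>
  have "balanced k V A (add_monoid V)
      (\<lambda>x c. ract V (ract V x a) c \<otimes>\<^bsub>add_monoid V\<^esub> ract V (ract V x b) c)"
    by (rule VA.balanced_cong[OF eq[symmetric] balanced_ract_ract[of "a \<oplus>\<^bsub>A\<^esub> b"]]) (simp_all add: a b)
  then have "left_action k A V (a \<oplus>\<^bsub>A\<^esub> b) v = tensor_lift k V A (add_monoid V)
      (\<lambda>x c. ract V (ract V x a) c \<otimes>\<^bsub>add_monoid V\<^esub> ract V (ract V x b) c) (coact V v)"
    unfolding left_action_def
    using eq v by (intro VA.tensor_lift_cong V.a_comm_group) simp_all
  also have "\<dots> = left_action k A V a v \<otimes>\<^bsub>add_monoid V\<^esub> left_action k A V b v"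
    unfolding left_action_def
    by (intro VA.tensor_lift_mult V.a_comm_group balanced_ract_ract a b coact_closed v)
  finally show ?thesis by simp
qed

lemma left_action_smult_left:
  assumes c: "c \<in> carrier k" and a: "a \<in> carrier A" and v: "v \<in> carrier V"
  shows "left_action k A V (c \<odot>\<^bsub>A\<^esub> a) v = c \<odot>\<^bsub>V\<^esub> left_action k A V a v"
proof -
  have scale: "(\<lambda>u. c \<odot>\<^bsub>V\<^esub> u) \<in> hom (add_monoid V) (add_monoid V)"
    using c by (auto intro!: homI simp: V.smult_r_distr)
  have "left_action k A V (c \<odot>\<^bsub>A\<^esub> a) v =
      tensor_lift k V A (add_monoid V) (\<lambda>x b. c \<odot>\<^bsub>V\<^esub> ract V (ract V x a) b) (coact V v)"
    unfolding left_action_def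
    by (intro VA.tensor_lift_cong V.a_comm_group balanced_hom[OF balanced_ract_ract[OF a] scale])
      (simp_all add: ract_smult_left ract_smult_right ract_closed a c v)
  also have "\<dots> = c \<odot>\<^bsub>V\<^esub> left_action k A V a v"
    unfolding left_action_def
    by (intro VA.hom_tensor_lift[OF V.a_comm_group V.a_comm_group _ scale, symmetric]
        balanced_ract_ract a coact_closed v)
  finally show ?thesis .
qed

text \<open>Since \<rho>(vb) = v0 \<otimes> v1 b, the formula gives a(vb) = v0 a (v1 b) = (v0 a v1)
  b.\<close>

lemma left_action_ract:
  assumes a: "a \<in> carrier A" and b: "b \<in> carrier A" and v: "v \<in> carrier V"
  shows "ract V (left_action k A V a v) b = left_action k A V a (ract V v b)"
proof -
  let ?act = "\<lambda>x c. ract V (ract V x a) c"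
  note H = V.a_comm_group
  have r: "(\<lambda>u. ract V u b) \<in> hom (add_monoid V) (add_monoid V)"
    by (rule linear_mapD(1)[OF linear_map_ract[OF b]])
  have "left_action k A V a (ract V v b) =
      tensor_lift k V A (add_monoid V) (\<lambda>x c. ?act x (c \<otimes>\<^bsub>A\<^esub> b)) (coact V v)"
    unfolding left_action_def coact_ract[OF v b]
    by (rule tensor_lift_tensor_map[OF VA.module_pair_axioms VA.module_pair_axioms linear_map_id
          linear_map_mult_right[OF b] H balanced_ract_ract[OF a] coact_closed[OF v]])
  also have "\<dots> = tensor_lift k V A (add_monoid V) (\<lambda>x c. ract V (?act x c) b) (coact V v)"
    by (intro VA.tensor_lift_cong H balanced_hom[OF balanced_ract_ract[OF a] r])
      (simp_all add: ract_mult ract_closed a b v)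
  also have "\<dots> = ract V (left_action k A V a v) b"
    unfolding left_action_def
    by (rule VA.hom_tensor_lift[OF H H balanced_ract_ract[OF a] r coact_closed[OF v], symmetric])
  finally show ?thesis by simp
qed

text \<open>Applying \<open>x \<otimes> b \<otimes> c \<mapsto> x \<otimes> b a c\<close> to coassociativity turns
  \<open>\<rho>(v\<^sub>0 a v\<^sub>1)\<close> into \<open>v\<^sub>0 \<otimes> a v\<^sub>1\<close>.\<close>

lemma coact_left_action:
  assumes a: "a \<in> carrier A" and v: "v \<in> carrier V"
  shows "coact V (left_action k A V a v) =
    tensor_map k V A V A (\<lambda>x. x) (\<lambda>b. a \<otimes>\<^bsub>A\<^esub> b) (coact V v)"
proof -
  \<comment> \<open>A lift in the first two factors with \<open>c\<close> as a parameter, the shape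
    that \<open>balanced_trilinear\<close> handles.\<close>
  let ?b = "\<lambda>u c. tensor_lift k V A VA.T (\<lambda>x b. pure_tensor k V A x (b \<otimes>\<^bsub>A\<^esub> (a \<otimes>\<^bsub>A\<^esub> c))) u"
  note H = VA.T.comm_group_axioms
  have inner: "balanced k V A VA.T (\<lambda>x b. pure_tensor k V A x (b \<otimes>\<^bsub>A\<^esub> (a \<otimes>\<^bsub>A\<^esub> c)))"
    if "c \<in> carrier A" for c
    using that a
    by (intro balanced_linear_map[OF VA.balanced_pure_tensor linear_map_id linear_map_mult_right]) simp
  have b: "balanced k (tensor k V A) A VA.T ?b"
    by (rule VA.balanced_trilinear[OF H inner _ _ VA.modules(2)])
      (simp_all add: a r_distr VA.pure_tensor_add_right VA.pure_tensor_smult smult_mult_right)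
  have outer: "balanced k V A VA.T (\<lambda>x c. ?b (coact V x) c)"
    by (rule balanced_linear_map[OF b coact_linear linear_map_id])
  have c: "coact V \<in> hom (add_monoid V) VA.T"
    using linear_mapD(1)[OF coact_linear] by (simp only: tensor_simps(1))
  have "coact V (left_action k A V a v) =
      tensor_lift k V A VA.T (\<lambda>x c. coact V (ract V (ract V x a) c)) (coact V v)"
    unfolding left_action_def
    by (rule VA.hom_tensor_lift[OF V.a_comm_group H balanced_ract_ract[OF a] c coact_closed[OF v]])
  \<comment> \<open>Right linearity of the coaction enters here: (x a) c = x (ac), hence \<rho>(x
    (ac)) = x0 \<otimes> x1 (ac), which is \<open>?b\<close> at \<rho>(x) and c.\<close>
  also have "\<dots> = tensor_lift k V A VA.T (\<lambda>x c. ?b (coact V x) c) (coact V v)"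
    by (intro VA.tensor_lift_cong H outer)
      (simp_all add: ract_mult[symmetric] coact_ract tensor_map_def a v)
  also have "\<dots> = tensor_lift k V A VA.T (\<lambda>x c. ?b (pure_tensor k V A x \<one>\<^bsub>A\<^esub>) c) (coact V v)"
    by (rule tensor_lift_coassociative[OF H b v])
  also have "\<dots> = tensor_map k V A V A (\<lambda>x. x) (\<lambda>b. a \<otimes>\<^bsub>A\<^esub> b) (coact V v)"
    unfolding tensor_map_def
    by (intro VA.tensor_lift_cong H
        balanced_linear_map[OF VA.balanced_pure_tensor linear_map_id linear_map_mult_left[OF a]])
      (simp_all add: VA.tensor_lift_pure[OF H inner] a v)
  finally show ?thesis .
qed

text \<open>By \<open>coact_left_action\<close>, \<rho>(bv) = v0 \<otimes> b v1, so a(bv) = v0 a (b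
  v1) = v0 (ab) v1.\<close>

lemma left_action_mult:
  assumes a: "a \<in> carrier A" and b: "b \<in> carrier A" and v: "v \<in> carrier V"
  shows "left_action k A V (a \<otimes>\<^bsub>A\<^esub> b) v = left_action k A V a (left_action k A V b v)"
proof -
  note H = V.a_comm_group
  have "left_action k A V a (left_action k A V b v) =
      tensor_lift k V A (add_monoid V) (\<lambda>x c. ract V (ract V x a) (b \<otimes>\<^bsub>A\<^esub> c)) (coact V v)"
    unfolding left_action_def[of k A V a] coact_left_action[OF b v]
    by (rule tensor_lift_tensor_map[OF VA.module_pair_axioms VA.module_pair_axioms linear_map_id
          linear_map_mult_left[OF b] H balanced_ract_ract[OF a] coact_closed[OF v]])
  also have "\<dots> = left_action k A V (a \<otimes>\<^bsub>A\<^esub> b) v"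
    unfolding left_action_def
    by (intro VA.tensor_lift_cong H balanced_ract_ract) (simp_all add: ract_mult ract_closed a b v)
  finally show ?thesis by simp
qed

text \<open>Apply x \<otimes> b \<otimes> c \<mapsto> x a b \<otimes> c to coassociativity. The
  inner coaction produces a v0 \<otimes> v1, while its replacement v0 \<otimes> 1 produces v0 a 1
  \<otimes> v1.\<close>

lemma tensor_map_left_action:
  assumes a: "a \<in> carrier A" and v: "v \<in> carrier V"
  shows "tensor_map k V A V A (left_action k A V a) (\<lambda>b. b) (coact V v) =
    tensor_map k V A V A (\<lambda>x. ract V x a) (\<lambda>b. b) (coact V v)"
proof -
  let ?act = "tensor_lift k V A (add_monoid V) (\<lambda>x b. ract V (ract V x a) b)"
  note H = VA.T.comm_group_axioms
  have "linear_map k (tensor k V A) V ?act"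
    by (rule VA.tensor_lift_linear[OF VA.modules(1) balanced_ract_ract[OF a]])
      (simp add: ract_smult_left ract_closed a)
  then have b: "balanced k (tensor k V A) A VA.T (\<lambda>u c. pure_tensor k V A (?act u) c)"
    by (rule balanced_linear_map[OF VA.balanced_pure_tensor _ linear_map_id])
  have "tensor_map k V A V A (left_action k A V a) (\<lambda>b. b) (coact V v) =
      tensor_lift k V A VA.T (\<lambda>x c. pure_tensor k V A (?act (pure_tensor k V A x \<one>\<^bsub>A\<^esub>)) c) (coact V v)"
    unfolding tensor_map_def left_action_def by (rule tensor_lift_coassociative[OF H b v])
  also have "\<dots> = tensor_map k V A V A (\<lambda>x. ract V x a) (\<lambda>b. b) (coact V v)"
    unfolding tensor_map_def
    by (intro VA.tensor_lift_cong H
        balanced_linear_map[OF VA.balanced_pure_tensor linear_map_ract[OF a] linear_map_id])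
      (simp_all add: VA.tensor_lift_pure[OF V.a_comm_group balanced_ract_ract[OF a]]
        ract_one ract_closed a v)
  finally show ?thesis .
qed

end

section \<open>Yetter-Drinfeld structures and comodule maps in terms of
  \<open>left_action\<close>\<close>

lemma yetter_drinfeldI:
  assumes "sweedler_comodule k A V"
    and lact: "\<And>a v. \<lbrakk>a \<in> carrier A; v \<in> carrier V\<rbrakk> \<Longrightarrow> lact V a v = left_action k A V a v"
  shows "yetter_drinfeld k A V"
proof -
  interpret sweedler_comodule k A V by fact
  note lin = linear_mapD[OF left_action_linear]
  show ?thesis
  proof unfold_locales
    fix a v assume a: "a \<in> carrier A" and v: "v \<in> carrier V"
    \<comment> \<open>Here \<open>lact V a\<close> occurs as an unapplied function and may differ
      from \<open>left_action k A V a\<close> off the carrier, so rewriting with \<open>lact\<close>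
      is not enough.\<close>
    have "tensor_map k V A V A (lact V a) (\<lambda>b. b) (coact V v) =
        tensor_map k V A V A (left_action k A V a) (\<lambda>b. b) (coact V v)"
      by (rule tensor_map_cong[OF VA.module_pair_axioms VA.module_pair_axioms left_action_linear linear_map_id])
        (simp_all add: lact a v)
    then show "tensor_map k V A V A (lact V a) (\<lambda>b. b) (coact V v) =
        tensor_map k V A V A (\<lambda>x. ract V x a) (\<lambda>b. b) (coact V v)"
      using tensor_map_left_action[OF a v] by simp
  qed (simp_all add: lact lin left_action_one left_action_add_left left_action_smult_left
      left_action_ract left_action_mult coact_left_action ract_closed)
qed

text \<open>Gives injectivity of the forgetful functor on objects: on the carriers, no choice of
  left action is left once the comodule is known.\<close>

lemma (in yetter_drinfeld) lact_eq_left_action: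
  assumes a: "a \<in> carrier A" and v: "v \<in> carrier V"
  shows "lact V a v = left_action k A V a v"
proof -
  have "lact V a v = tensor_lift k V A (add_monoid V) (ract V) (coact V (lact V a v))"
    by (simp add: counital lact_closed a v)
  also have "\<dots> = tensor_lift k V A (add_monoid V) (\<lambda>x b. ract V x (a \<otimes>\<^bsub>A\<^esub> b)) (coact V v)"
    unfolding coact_lact[OF a v]
    by (rule tensor_lift_tensor_map[OF VA.module_pair_axioms VA.module_pair_axioms linear_map_id
          linear_map_mult_left[OF a] V.a_comm_group balanced_ract coact_closed[OF v]])
  also have "\<dots> = left_action k A V a v"
    unfolding left_action_def
    by (intro VA.tensor_lift_cong V.a_comm_group balanced_ract_ract) (simp_all add: ract_mult a v)
  finally show ?thesis .
qed

lemma comodule_map_closed: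
  "\<lbrakk>comodule_map k A V W f; v \<in> carrier V\<rbrakk> \<Longrightarrow> f v \<in> carrier W"
  unfolding comodule_map_def by (metis linear_mapD(2))

text \<open>Right linearity gives f(v0 a v1) = f(v0) a v1, and compatibility with the coactions
  identifies f(v0) \<otimes> v1 with the coaction of f(v).\<close>

lemma comodule_map_left_action:
  assumes "sweedler_comodule k A V" "sweedler_comodule k A W" and f: "comodule_map k A V W f"
    and a: "a \<in> carrier A" and v: "v \<in> carrier V"
  shows "f (left_action k A V a v) = left_action k A W a (f v)"
proof -
  interpret V: sweedler_comodule k A V by fact
  interpret W: sweedler_comodule k A W by fact
  have lin: "linear_map k V W f"
    and f_ract: "\<And>v a. \<lbrakk>v \<in> carrier V; a \<in> carrier A\<rbrakk> \<Longrightarrow> f (ract V v a) = ract W (f v) a"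
    and f_coact: "coact W (f v) = tensor_map k V A W A f (\<lambda>a. a) (coact V v)"
    using f v unfolding comodule_map_def by auto
  note H = W.V.a_comm_group and b = V.balanced_ract_ract[OF a] W.balanced_ract_ract[OF a]
  note hom = linear_mapD(1)[OF lin]
  have "f (left_action k A V a v) =
      tensor_lift k V A (add_monoid W) (\<lambda>x c. f (ract V (ract V x a) c)) (coact V v)"
    unfolding left_action_def
    by (rule V.VA.hom_tensor_lift[OF V.V.a_comm_group H b(1) hom V.coact_closed[OF v]])
  also have "\<dots> = tensor_lift k V A (add_monoid W) (\<lambda>x c. ract W (ract W (f x) a) c) (coact V v)"
    by (intro V.VA.tensor_lift_cong H balanced_linear_map[OF b(2) lin linear_map_id])
      (simp_all add: f_ract V.ract_closed a v)
  also have "\<dots> = left_action k A W a (f v)"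
    unfolding left_action_def f_coact
    by (rule tensor_lift_tensor_map[OF V.VA.module_pair_axioms W.VA.module_pair_axioms lin
          linear_map_id H b(2) V.coact_closed[OF v], symmetric])
  finally show ?thesis .
qed

text \<open>Makes the forgetful functor fully faithful in the strict sense: corresponding hom-sets
  are equal, so both functors can be the identity on arrows.\<close>

lemma yd_map_iff_comodule_map:
  assumes "yetter_drinfeld k A V" "yetter_drinfeld k A W"
  shows "yd_map k A V W f \<longleftrightarrow> comodule_map k A V W f"
proof -
  interpret V: yetter_drinfeld k A V by fact
  interpret W: yetter_drinfeld k A W by fact
  have "f (lact V a v) = lact W a (f v)"
    if f: "comodule_map k A V W f" and a: "a \<in> carrier A" and v: "v \<in> carrier V" for a v
  proof -
    have "f v \<in> carrier W"
      by (rule comodule_map_closed[OF f v])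
    then show ?thesis
      using comodule_map_left_action[OF V.sweedler_comodule_axioms W.sweedler_comodule_axioms f a v]
      by (simp add: V.lact_eq_left_action W.lact_eq_left_action a v)
  qed
  then show ?thesis unfolding yd_map_def by blast
qed


section \<open>The categories and the inverse functor\<close>

lemma comodule_map_id:
  assumes "sweedler_comodule k A V"
  shows "comodule_map k A V V (\<lambda>v\<in>carrier V. v)"
proof -
  interpret sweedler_comodule k A V by fact
  have "tensor_map k V A V A (\<lambda>v\<in>carrier V. v) (\<lambda>a. a) x = x" if "x \<in> carrier VA.T" for x
    using tensor_map_cong[OF VA.module_pair_axioms VA.module_pair_axioms linear_map_id linear_map_id _ _ that,
        of "\<lambda>v\<in>carrier V. v" "\<lambda>a. a"]
    by (simp add: tensor_map_id[OF VA.module_pair_axioms that])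
  moreover have "linear_map k V V (\<lambda>v\<in>carrier V. v)"
    by (intro linear_mapI) simp_all
  ultimately show ?thesis
    unfolding comodule_map_def by (simp add: ract_closed)
qed

lemma comodule_map_compose:
  assumes "sweedler_comodule k A V" "sweedler_comodule k A W" "sweedler_comodule k A X"
    and f: "comodule_map k A V W f" and g: "comodule_map k A W X g"
  shows "comodule_map k A V X (compose (carrier V) g f)"
proof -
  interpret V: sweedler_comodule k A V by fact
  interpret W: sweedler_comodule k A W by fact
  interpret X: sweedler_comodule k A X by fact
  have lf: "linear_map k V W f" and lg: "linear_map k W X g"
    using f g unfolding comodule_map_def by auto
  note linD = linear_mapD[OF lf] linear_mapD[OF lg]
  have lgf: "linear_map k V X (\<lambda>v. g (f v))"
    by (intro linear_mapI) (simp_all add: linD)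
  have "tensor_map k W A X A g (\<lambda>a. a) (tensor_map k V A W A f (\<lambda>a. a) u) =
      tensor_map k V A X A (compose (carrier V) g f) (\<lambda>a. a) u" if u: "u \<in> carrier V.VA.T" for u
    using tensor_map_cong[OF V.VA.module_pair_axioms X.VA.module_pair_axioms lgf linear_map_id _ _ u,
        of "compose (carrier V) g f" "\<lambda>a. a"]
    by (simp add: tensor_map_comp[OF V.VA.module_pair_axioms W.VA.module_pair_axioms X.VA.module_pair_axioms
          lf linear_map_id lg linear_map_id u] compose_eq)
  moreover have "linear_map k V X (compose (carrier V) g f)"
    by (intro linear_mapI) (simp_all add: linD compose_eq)
  ultimately show ?thesis
    using f g unfolding comodule_map_def by (simp add: linD compose_eq V.ract_closed)
qed

lemma category_comodule: "category (comodule_category k A)"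
  by unfold_locales
    (auto simp: comodule_category_def comodule_map_id compose_def comodule_map_closed extensional_def fun_eq_iff
      intro: comodule_map_compose[unfolded compose_def])

lemma category_yd: "category (yd_category k A)"
  by unfold_locales
    (auto simp: yd_category_def yd_map_iff_comodule_map comodule_map_id compose_def comodule_map_closed
      extensional_def fun_eq_iff yetter_drinfeld.axioms(2)
      intro: comodule_map_compose[unfolded compose_def, OF yetter_drinfeld.axioms(2)
        yetter_drinfeld.axioms(2) yetter_drinfeld.axioms(2)])

text \<open>The tensor constants and locales take whole records, so passing between a comodule and a
  Yetter-Drinfeld record changes the terms even when the structure is the same. Unfolding the tensor
  constants shows that their values depend only on the listed fields.\<close>

lemma
  assumes fields: "carrier V' = carrier V" "add V' = add V" "zero V' = zero V" "smult V' = smult V"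
      "ract V' = ract V" "coact V' = coact V"
  shows sweedler_comodule_cong: "sweedler_comodule k A V \<Longrightarrow> sweedler_comodule k A V'"
    and left_action_cong: "left_action k A V' = left_action k A V"
    and comodule_map_cong: "\<lbrakk>carrier W' = carrier W; add W' = add W; smult W' = smult W;
      ract W' = ract W; coact W' = coact W\<rbrakk> \<Longrightarrow> comodule_map k A V' W' = comodule_map k A V W"
proof -
  note tensor_defs = tensor_map_def tensor_lift_def pure_tensor_def tensor_group_def tensor_kernel_def
    tensor_relations_def tensor_def
  show "left_action k A V' = left_action k A V"
    by (simp add: left_action_def fun_eq_iff tensor_defs hom_def fields)
  show "comodule_map k A V' W' = comodule_map k A V W" if "carrier W' = carrier W" "add W' = add W"
      "smult W' = smult W" "ract W' = ract W" "coact W' = coact W"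
    by (simp add: comodule_map_def linear_map_def fun_eq_iff tensor_defs hom_def fields that)
  assume "sweedler_comodule k A V"
  then interpret sweedler_comodule k A V .
  have "module k V'"
  proof (rule moduleI)
    show "abelian_group V'"
      by (rule abelian_groupI) (auto simp: fields V.a_ac V.l_neg intro: V.a_inv_closed)
  qed (simp_all add: fields module.axioms(1)[OF VA.modules(1)] V.smult_l_distr V.smult_r_distr V.smult_assoc1)
  then interpret V': module k V' .
  show "sweedler_comodule k A V'"
  proof unfold_locales
    show "linear_map k V' (tensor k V' A) (coact V')"
      using coact_linear by (simp add: linear_map_def tensor_defs hom_def fields)
  next
    fix v assume v: "v \<in> carrier V'"
    show "tensor_lift k V' A (add_monoid V') (ract V') (coact V' v) = v"
      using counital[of v] v by (simp add: tensor_defs hom_def fields)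
    show "tensor_map k V' A (tensor k V' A) A (coact V') (\<lambda>a. a) (coact V' v) =
        tensor_map k V' A (tensor k V' A) A (\<lambda>x. pure_tensor k V' A x \<one>\<^bsub>A\<^esub>) (\<lambda>a. a) (coact V' v)"
      using coassociative[of v] v by (simp add: tensor_defs hom_def fields)
    show "coact V' (ract V' v a) = tensor_map k V' A V' A (\<lambda>x. x) (\<lambda>b. b \<otimes>\<^bsub>A\<^esub> a) (coact V' v)"
      if "a \<in> carrier A" for a
      using coact_ract[of v a] v that by (simp add: tensor_defs hom_def fields)
  qed (simp_all add: fields ract_closed ract_add_left ract_add_right ract_mult ract_one
      ract_smult_left ract_smult_right)
qed

text \<open>The object part of the inverse functor. The value \<open>undefined\<close> off the
  carriers makes the result satisfy \<open>normal_yd_module\<close>, so that both round trips are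
  equalities of records.\<close>

definition with_left_action ::
  "('k, 'r) ring_scheme \<Rightarrow> ('k, 'a, 'm) module_scheme \<Rightarrow> ('k, 'a, 'v) comodule \<Rightarrow> ('k, 'a, 'v) yd_module"
  where "with_left_action k A V = comodule.extend V (yd_module.fields
    (\<lambda>a v. if a \<in> carrier A \<and> v \<in> carrier V then left_action k A V a v else undefined))"

lemma with_left_action_simps [simp]:
  "carrier (with_left_action k A V) = carrier V"
  "monoid.mult (with_left_action k A V) = monoid.mult V"
  "one (with_left_action k A V) = one V"
  "add (with_left_action k A V) = add V"
  "zero (with_left_action k A V) = zero V"
  "smult (with_left_action k A V) = smult V"
  "ract (with_left_action k A V) = ract V"
  "coact (with_left_action k A V) = coact V"
  "lact (with_left_action k A V) =
    (\<lambda>a v. if a \<in> carrier A \<and> v \<in> carrier V then left_action k A V a v else undefined)"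
  "comodule.truncate (with_left_action k A V) = V"
  by (simp_all add: with_left_action_def comodule.defs yd_module.defs)

lemma truncate_simps [simp]:
  "carrier (comodule.truncate V) = carrier V"
  "monoid.mult (comodule.truncate V) = monoid.mult V"
  "one (comodule.truncate V) = one V"
  "add (comodule.truncate V) = add V"
  "zero (comodule.truncate V) = zero V"
  "smult (comodule.truncate V) = smult V"
  "ract (comodule.truncate V) = ract V"
  "coact (comodule.truncate V) = coact V"
  by (simp_all add: comodule.defs)

text \<open>Only the field \<open>lact\<close> is in question: on the carriers it is forced by
  \<open>lact_eq_left_action\<close>, elsewhere both sides are \<open>undefined\<close> by
  normality.\<close>

lemma with_left_action_truncate:
  assumes "yetter_drinfeld k A V" "normal_yd_module k A V"
  shows "with_left_action k A (comodule.truncate V) = V"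
proof (rule yd_module.equality)
  have "left_action k A (comodule.truncate V) = left_action k A V"
    by (rule left_action_cong) simp_all
  then show "lact (with_left_action k A (comodule.truncate V)) = lact V"
    using assms(2) yetter_drinfeld.lact_eq_left_action[OF assms(1)]
    by (auto simp: normal_yd_module_def fun_eq_iff)
qed simp_all

lemma yetter_drinfeld_with_left_action:
  assumes "sweedler_comodule k A V"
  shows "yetter_drinfeld k A (with_left_action k A V)"
proof (rule yetter_drinfeldI)
  show "sweedler_comodule k A (with_left_action k A V)"
    by (rule sweedler_comodule_cong[OF _ _ _ _ _ _ assms]) simp_all
  have "left_action k A (with_left_action k A V) = left_action k A V"
    by (rule left_action_cong) simp_all
  then show "lact (with_left_action k A V) a v = left_action k A (with_left_action k A V) a v"
    if "a \<in> carrier A" "v \<in> carrier (with_left_action k A V)" for a v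
    using that by simp
qed

lemma sweedler_comodule_truncate:
  assumes "yetter_drinfeld k A V"
  shows "sweedler_comodule k A (comodule.truncate V)"
  by (rule sweedler_comodule_cong[OF _ _ _ _ _ _ yetter_drinfeld.axioms(2)[OF assms]]) simp_all

theorem proposition2p2:
  fixes k :: "('k, 'r) ring_scheme" and A :: "('k, 'a, 'm) module_scheme"
  assumes "cring k" and "k_algebra k A"
  shows "isomorphism_of_categories
    (yd_category k A :: (('k, 'a, 'v) yd_module, 'v \<Rightarrow> 'v) category_data)
    (comodule_category k A :: (('k, 'a, 'v) comodule, 'v \<Rightarrow> 'v) category_data)
    forget_left_action"
proof -
  let ?Y = "yd_category k A :: (('k, 'a, 'v) yd_module, 'v \<Rightarrow> 'v) category_data"
  let ?M = "comodule_category k A :: (('k, 'a, 'v) comodule, 'v \<Rightarrow> 'v) category_data"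
  let ?U = "forget_left_action :: (('k, 'a, 'v) yd_module, 'v \<Rightarrow> 'v, ('k, 'a, 'v) comodule, 'v \<Rightarrow> 'v) functor_data"
  let ?G = "\<lparr>omap = with_left_action k A, amap = (\<lambda>V W f. f)\<rparr>
    :: (('k, 'a, 'v) comodule, 'v \<Rightarrow> 'v, ('k, 'a, 'v) yd_module, 'v \<Rightarrow> 'v) functor_data"
  have truncate_map: "comodule_map k A (comodule.truncate V) (comodule.truncate W) = comodule_map k A V W"
    for V W :: "('k, 'a, 'v) yd_module"
    by (rule comodule_map_cong) simp_all
  have extend_map: "comodule_map k A (with_left_action k A V) (with_left_action k A W) = comodule_map k A V W"
    for V W :: "('k, 'a, 'v) comodule"
    by (rule comodule_map_cong) simp_all
  have "category_functor ?Y ?M ?U"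
    by (intro category_functor.intro category_yd category_comodule category_functor_axioms.intro)
      (auto simp: yd_category_def comodule_category_def forget_left_action_def sweedler_comodule_truncate
        normal_yd_module_def normal_comodule_def yd_map_iff_comodule_map truncate_map)
  moreover have "category_functor ?M ?Y ?G"
    by (intro category_functor.intro category_yd category_comodule category_functor_axioms.intro)
      (auto simp: yd_category_def comodule_category_def yetter_drinfeld_with_left_action
        normal_yd_module_def normal_comodule_def yd_map_iff_comodule_map extend_map)
  \<comment> \<open>Arrows are unchanged by both functors, so only objects need an argument;
    truncating an extended record returns the original by the record simplification rules.\<close>
  moreover have "left_inverse_functor ?Y ?G ?U" "left_inverse_functor ?M ?U ?G"
    by (simp_all add: left_inverse_functor_def yd_category_def comodule_category_def forget_left_action_def
        with_left_action_truncate)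
  ultimately show ?thesis
    unfolding isomorphism_of_categories_def by blast
qed

end
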